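(* Let $$f(q,p,\varepsilon)=\sum_{n\geq0}\frac{\varepsilon^n}{n!}f_n(q,p),\qquad W(q,p,\varepsilon)=\sum_{n\geq0}\frac{\varepsilon^n}{n!}W_n(q,p)$$ be analytic functions. Let new variables $(Q,P)$ be defined by letting $q=q(Q,P,\varepsilon)$ and $p=p(Q,P,\varepsilon)$ be the solution of the initial value problem $$\frac{dq}{d\varepsilon}=\frac{\partial W}{\partial p}(q,p,\varepsilon),\quad q(0)=Q,\qquad \frac{dp}{d\varepsilon}=-\frac{\partial W}{\partial q}(q,p,\varepsilon),\quad p(0)=P.$$ Then the expression of $f$ in the new variables is given by $$F(Q,P,\varepsilon):=f\bigl(q(Q,P,\varepsilon),p(Q,P,\varepsilon),\varepsilon\bigr)=\sum_{n\geq0}\frac{\varepsilon^n}{n!}F_n(Q,P),$$ where the $F_n$ are determined iteratively as follows. Let $f^0_n(Q,P)=f_n(Q,P)$ for all $n\ge 0$, and define functions $f^k_n(Q,P)$, $k\geq1$, $n\ge 0$, recursively by $$f^k_n(Q,P)=f^{k-1}_{n+1}(Q,P)+\sum_{m=0}^n\binom nm\{f^{k-1}_{n-m};W_m\}(Q,P).$$ Then $F_n(Q,P)=f^n_0(Q,P)$ for all $n\geq0$.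
   Context: Here $q=(q_1,\dots,q_d)$ and $p=(p_1,\dots,p_d)$ belong to $\mathbb{R}^d$, with $(q,p)$ in an open subset of $\mathbb{R}^{2d}$, and $\varepsilon$ is a small parameter ($|\varepsilon|$ small enough for the series to converge). The Poisson bracket of two differentiable functions is $$\{f;g\}=\sum_{i=1}^d\frac{\partial f}{\partial q_i}\frac{\partial g}{\partial p_i}-\frac{\partial f}{\partial p_i}\frac{\partial g}{\partial q_i}.$$ *)

theory Defs
  imports "HOL-Analysis.Analysis"
begin

text \<open>
  Real analyticity in several variables: near every point of \<open>S\<close> the function is the sum of a
  power series, indexed by the multi-indices \<open>\<alpha> : Basis \<rightarrow> nat\<close> and summed unconditionally.
\<close>

definition real_analytic_on :: "('a::euclidean_space \<Rightarrow> real) \<Rightarrow> 'a set \<Rightarrow> bool" where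
  "real_analytic_on g S \<longleftrightarrow>
     (\<forall>a\<in>S. \<exists>(c :: ('a \<Rightarrow> nat) \<Rightarrow> real) r. r > 0 \<and>
        (\<forall>x\<in>ball a r.
           ((\<lambda>\<alpha>. c \<alpha> * (\<Prod>b\<in>Basis. ((x - a) \<bullet> b) ^ \<alpha> b)) has_sum g x) (Basis \<rightarrow>\<^sub>E UNIV)))"

definition partial_q ::
    "'d::finite \<Rightarrow> (real^'d \<Rightarrow> real^'d \<Rightarrow> real) \<Rightarrow> real^'d \<Rightarrow> real^'d \<Rightarrow> real" where
  "partial_q i g q p = deriv (\<lambda>t. g (q + t *\<^sub>R axis i 1) p) 0"

definition partial_p ::
    "'d::finite \<Rightarrow> (real^'d \<Rightarrow> real^'d \<Rightarrow> real) \<Rightarrow> real^'d \<Rightarrow> real^'d \<Rightarrow> real" where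
  "partial_p i g q p = deriv (\<lambda>t. g q (p + t *\<^sub>R axis i 1)) 0"

definition poisson_bracket ::
    "(real^'d::finite \<Rightarrow> real^'d \<Rightarrow> real) \<Rightarrow> (real^'d \<Rightarrow> real^'d \<Rightarrow> real) \<Rightarrow>
      real^'d \<Rightarrow> real^'d \<Rightarrow> real" where
  "poisson_bracket f g q p =
     (\<Sum>i\<in>UNIV. partial_q i f q p * partial_p i g q p - partial_p i f q p * partial_q i g q p)"

text \<open>\<open>lie_coeff f W k n\<close> is the function \<open>f\<^sup>k\<^sub>n\<close>.\<close>

primrec lie_coeff ::
    "(nat \<Rightarrow> real^'d::finite \<Rightarrow> real^'d \<Rightarrow> real) \<Rightarrow> (nat \<Rightarrow> real^'d \<Rightarrow> real^'d \<Rightarrow> real) \<Rightarrow>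
      nat \<Rightarrow> nat \<Rightarrow> real^'d \<Rightarrow> real^'d \<Rightarrow> real" where
  "lie_coeff f W 0 = f"
| "lie_coeff f W (Suc k) = (\<lambda>n Q P.
     lie_coeff f W k (Suc n) Q P +
     (\<Sum>m=0..n. real (n choose m) * poisson_bracket (lie_coeff f W k (n - m)) (W m) Q P))"

end

theory Submission
  imports Defs
begin

text \<open>
  Adjoin \<open>\<epsilon>\<close> to the phase space as a further coordinate. The initial value problem becomes the
  autonomous equation \<open>\<gamma>' = V(\<gamma>)\<close> on points \<open>(q, p, \<epsilon>)\<close>, where \<open>V\<close> is the Hamiltonian field of
  \<open>W\<close> with last component \<open>1\<close>, and along a solution every function \<open>g\<close> of \<open>(q, p, \<epsilon>)\<close> has
  derivative \<open>L g = \<partial>g/\<partial>\<epsilon> + {g; W}\<close>. So the \<open>n\<close>-th derivative of \<open>\<epsilon> \<mapsto> f(\<gamma> \<epsilon>)\<close> is \<open>L\<^sup>n f\<close> at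
  \<open>\<gamma> \<epsilon>\<close>, and two things remain: that the Taylor series converges to the function, and that its
  coefficients are the numbers \<open>f\<^sup>n\<^sub>0(Q, P)\<close>.

  Convergence needs no analyticity of the solution, only that \<open>L\<^sup>n f\<close> is at most \<open>N K\<^sup>n n!\<close> on a
  neighbourhood which the solution does not leave; then the Lagrange remainder at step \<open>n\<close> is at
  most \<open>N (K \<bar>\<epsilon>\<bar>)\<^sup>n\<close>. The bound comes from Cauchy's estimate in the form of absolutely
  convergent power series (\<open>majorized\<close>): a partial derivative costs a factor \<open>1/\<delta>\<close> if the radius
  shrinks by \<open>\<delta>\<close> (\<open>majorized_pd\<close>). Dividing half of the radius \<open>R\<close> evenly among \<open>n\<close>
  applications of \<open>L\<close> gives \<open>(C n)\<^sup>n\<close> (\<open>majorized_lieD_power\<close>), and \<open>n\<^sup>n \<le> e\<^sup>n n!\<close>. The resulting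
  radius in \<open>\<epsilon>\<close> depends only on the cube, hence is uniform near a given \<open>(Q, P)\<close>
  (\<open>lie_series_sums_along_trajectory\<close>).

  The coefficients are identified by the stronger claim that \<open>f\<^sup>k\<^sub>n(x, y)\<close> is the \<open>n\<close>-th
  \<open>\<epsilon>\<close>-derivative of \<open>L\<^sup>k f\<close> at \<open>(x, y, 0)\<close> (\<open>lie_coeff_eq_pd_funpow\<close>). In the step from \<open>k\<close> to
  \<open>k + 1\<close>, the derivative \<open>\<partial>/\<partial>\<epsilon>\<close> commutes with the partial derivatives in the bracket, so the
  Leibniz rule turns the \<open>n\<close>-th \<open>\<epsilon>\<close>-derivative of \<open>{g; W}\<close> into the binomial sum of the recursion
  (\<open>pd_funpow_lieD\<close>).
\<close>

section \<open>Absolutely convergent power series on a cube\<close>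

text \<open>
  The cubes are open balls for the maximum norm: on them all monomials of multidegree \<open>k\<close>
  centred at \<open>a\<close> are bounded by \<open>r\<^sup>k\<close>.
\<close>

definition cube :: "'a::euclidean_space \<Rightarrow> real \<Rightarrow> 'a set" where
  "cube a r = box (a - r *\<^sub>R One) (a + r *\<^sub>R One)"

lemma mem_cube: "x \<in> cube a r \<longleftrightarrow> (\<forall>b\<in>Basis. \<bar>(x - a) \<bullet> b\<bar> < r)"
  by (auto simp: cube_def mem_box algebra_simps abs_less_iff)

lemma open_cube: "open (cube a r)"
  by (simp add: cube_def open_box)

lemma cube_mono: "r \<le> s \<Longrightarrow> cube a r \<subseteq> cube a s"
  by (force simp: mem_cube)

definition multidegree :: "('a::euclidean_space \<Rightarrow> nat) \<Rightarrow> nat" where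
  "multidegree \<alpha> = (\<Sum>b\<in>Basis. \<alpha> b)"

definition monomial :: "('a::euclidean_space \<Rightarrow> nat) \<Rightarrow> 'a \<Rightarrow> real" where
  "monomial \<alpha> y = (\<Prod>b\<in>Basis. (y \<bullet> b) ^ \<alpha> b)"

text \<open>
  The exponents \<open>\<alpha> i\<close> need not be distinct. Allowing repeated monomials makes sums, products and
  derivatives immediate on the level of terms, since no regrouping by multi-index is needed. The
  bound \<open>N\<close> controls the sum of the absolute values on the closed cube, which is the norm in which
  Cauchy's estimate below is stated.
\<close>

definition expands ::
    "'i set \<Rightarrow> ('i \<Rightarrow> real) \<Rightarrow> ('i \<Rightarrow> 'a \<Rightarrow> nat) \<Rightarrow> 'a::euclidean_space \<Rightarrow> real \<Rightarrow> real \<Rightarrow> ('a \<Rightarrow> real) \<Rightarrow> bool"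
  where
  "expands I c \<alpha> a r N g \<longleftrightarrow>
     (\<exists>s\<le>N. ((\<lambda>i. \<bar>c i\<bar> * r ^ multidegree (\<alpha> i)) has_sum s) I) \<and>
     (\<forall>x\<in>cube a r. ((\<lambda>i. c i * monomial (\<alpha> i) (x - a)) has_sum g x) I)"

text \<open>
  The index type is fixed to be \<^typ>\<open>nat\<close> so that the theorems on series of functions apply.
\<close>

definition majorized :: "'a::euclidean_space \<Rightarrow> real \<Rightarrow> real \<Rightarrow> ('a \<Rightarrow> real) \<Rightarrow> bool" where
  "majorized a r N g \<longleftrightarrow> (\<exists>(c :: nat \<Rightarrow> real) \<alpha>. expands UNIV c \<alpha> a r N g)"

lemma expands_reindex:
  assumes "inj_on h J" "h ` J = I"
  shows "expands J (\<lambda>j. c (h j)) (\<lambda>j. \<alpha> (h j)) a r N g \<longleftrightarrow> expands I c \<alpha> a r N g"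
proof -
  have "bij_betw h J I"
    using assms by (simp add: bij_betw_def)
  then show ?thesis
    unfolding expands_def
    using has_sum_reindex_bij_betw[of h J I "\<lambda>i. \<bar>c i\<bar> * r ^ multidegree (\<alpha> i)"]
      has_sum_reindex_bij_betw[of h J I "\<lambda>i. c i * monomial (\<alpha> i) (_ - a)"]
    by simp
qed

text \<open>
  A countable index set embeds into the natural numbers; the remaining indices get coefficient zero.
\<close>

lemma expands_imp_majorized:
  assumes "countable I" and "expands I c \<alpha> a r N g"
  shows "majorized a r N g"
proof -
  define h where "h = from_nat_into I"
  define K where "K = to_nat_on I ` I"
  have inj: "inj_on h K" and im: "h ` K = I"
    using assms(1) unfolding h_def K_def
    by (auto simp: inj_on_def image_image intro!: image_eqI)
  have "expands K (\<lambda>j. c (h j)) (\<lambda>j. \<alpha> (h j)) a r N g"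
    by (rule expands_reindex[OF inj im, THEN iffD2, OF assms(2)])
  moreover have pad: "(F has_sum u) K \<longleftrightarrow> (G has_sum u) UNIV"
    if "\<And>j. G j = (if j \<in> K then F j else 0)" for F G :: "nat \<Rightarrow> real" and u
    by (rule has_sum_cong_neutral) (auto simp: that)
  have "expands K (\<lambda>j. c (h j)) (\<lambda>j. \<alpha> (h j)) a r N g \<longleftrightarrow>
      expands UNIV (\<lambda>j. if j \<in> K then c (h j) else 0) (\<lambda>j. \<alpha> (h j)) a r N g"
    unfolding expands_def
    by (intro arg_cong2[where f = "(\<and>)"] ex_cong1 ball_cong conj_cong refl pad) auto
  ultimately have "expands UNIV (\<lambda>j. if j \<in> K then c (h j) else 0) (\<lambda>j. \<alpha> (h j)) a r N g"
    by blast
  then show ?thesis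
    unfolding majorized_def by blast
qed

lemma majorized_weaken:
  assumes "majorized a r N g" "r' \<le> r" "0 \<le> r'" "N \<le> N'"
  shows "majorized a r' N' g"
proof -
  obtain c \<alpha> s where s: "s \<le> N" "((\<lambda>n::nat. \<bar>c n\<bar> * r ^ multidegree (\<alpha> n)) has_sum s) UNIV"
    and e: "\<forall>x\<in>cube a r. ((\<lambda>i. c i * monomial (\<alpha> i) (x - a)) has_sum g x) UNIV"
    using assms(1) unfolding majorized_def expands_def by blast
  have le: "\<bar>c n\<bar> * r' ^ multidegree (\<alpha> n) \<le> \<bar>c n\<bar> * r ^ multidegree (\<alpha> n)" for n
    by (intro mult_left_mono power_mono) (use assms in auto)
  have "(\<lambda>n::nat. \<bar>c n\<bar> * r' ^ multidegree (\<alpha> n)) summable_on UNIV"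
    by (rule summable_on_comparison_test[OF has_sum_imp_summable[OF s(2)]]) (use le assms in auto)
  then obtain s' where s': "((\<lambda>n::nat. \<bar>c n\<bar> * r' ^ multidegree (\<alpha> n)) has_sum s') UNIV"
    unfolding summable_on_def by blast
  have "s' \<le> s"
    by (rule has_sum_mono[OF s' s(2)]) (rule le)
  then show ?thesis
    unfolding majorized_def expands_def
    using s' e cube_mono[OF assms(2), of a] s(1) assms(4)
    by (intro exI[of _ c] exI[of _ \<alpha>] conjI exI[of _ s']) auto
qed

lemma majorized_nonneg: "majorized a r N g \<Longrightarrow> 0 \<le> r \<Longrightarrow> 0 \<le> N"
  unfolding majorized_def expands_def
  by (meson abs_ge_zero has_sum_nonneg mult_nonneg_nonneg order_trans zero_le_power)

lemma monomial_bound: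
  assumes "x \<in> cube a r"
  shows "\<bar>monomial \<alpha> (x - a)\<bar> \<le> r ^ multidegree \<alpha>"
proof -
  have "\<bar>monomial \<alpha> (x - a)\<bar> = (\<Prod>b\<in>Basis. \<bar>(x - a) \<bullet> b\<bar> ^ \<alpha> b)"
    by (simp add: monomial_def abs_prod power_abs)
  also have "\<dots> \<le> (\<Prod>b\<in>(Basis::'a set). r ^ \<alpha> b)"
    using assms by (intro prod_mono) (auto simp: mem_cube intro!: power_mono intro: less_imp_le)
  also have "\<dots> = r ^ multidegree \<alpha>"
    by (simp add: multidegree_def power_sum)
  finally show ?thesis .
qed

lemma majorized_bound:
  assumes "majorized a r N g" "x \<in> cube a r"
  shows "\<bar>g x\<bar> \<le> N"
proof -
  obtain c \<alpha> s where s: "s \<le> N" "((\<lambda>n::nat. \<bar>c n\<bar> * r ^ multidegree (\<alpha> n)) has_sum s) UNIV"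
    and e: "((\<lambda>i. c i * monomial (\<alpha> i) (x - a)) has_sum g x) UNIV"
    using assms unfolding majorized_def expands_def by blast
  have le: "norm (c n * monomial (\<alpha> n) (x - a)) \<le> \<bar>c n\<bar> * r ^ multidegree (\<alpha> n)" for n
    using monomial_bound[of x a r "\<alpha> n"] assms(2) by (simp add: abs_mult mult_left_mono)
  have "(\<lambda>n. norm (c n * monomial (\<alpha> n) (x - a))) summable_on UNIV"
    using summable_on_iff_abs_summable_on_real[THEN iffD1, OF has_sum_imp_summable[OF e]] .
  then obtain u where u: "((\<lambda>n. norm (c n * monomial (\<alpha> n) (x - a))) has_sum u) UNIV"
    unfolding summable_on_def by blast
  have "norm (g x) \<le> u"
    by (rule norm_has_sum_bound[OF u e])
  also have "u \<le> s"
    by (rule has_sum_mono[OF u s(2)]) (rule le)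
  finally show ?thesis using s(1) by simp
qed

lemma majorized_const: "majorized a r \<bar>k\<bar> (\<lambda>x. k)"
proof (rule expands_imp_majorized)
  show "expands {()} (\<lambda>_. k) (\<lambda>_ _. 0) a r \<bar>k\<bar> (\<lambda>x. k)"
    unfolding expands_def
    by (auto simp: multidegree_def monomial_def intro!: has_sum_finiteI)
qed auto

lemma monomial_add: "monomial (\<lambda>b. \<alpha> b + \<beta> b) y = monomial \<alpha> y * monomial \<beta> y"
  by (simp add: monomial_def power_add prod.distrib)

lemma multidegree_add: "multidegree (\<lambda>b. \<alpha> b + \<beta> b) = multidegree \<alpha> + multidegree \<beta>"
  by (simp add: multidegree_def sum.distrib)

lemma has_sum_times:
  fixes f :: "'i \<Rightarrow> real" and g :: "'j \<Rightarrow> real"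
  assumes "(f has_sum s) I" "(g has_sum t) J"
  shows "((\<lambda>(i, j). f i * g j) has_sum (s * t)) (I \<times> J)"
proof (rule has_sum_SigmaI[where g = "\<lambda>i. f i * t"])
  show "((\<lambda>j. case (i, j) of (i, j) \<Rightarrow> f i * g j) has_sum f i * t) J" for i
    using has_sum_cmult_right[OF assms(2)] by simp
  show "((\<lambda>i. f i * t) has_sum s * t) I"
    by (rule has_sum_cmult_left[OF assms(1)])
  have f: "(\<lambda>i. norm (f i)) summable_on I" and g: "(\<lambda>j. norm (g j)) summable_on J"
    by (rule summable_on_iff_abs_summable_on_real[THEN iffD1, OF has_sum_imp_summable],
        rule assms)+
  have "(\<lambda>x. norm (case x of (i, j) \<Rightarrow> f i * g j)) summable_on I \<times> J"
    unfolding Infinite_Sum.abs_summable_on_Sigma_iff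
    using summable_on_cmult_left[OF f] summable_on_cmult_right[OF g]
    by (simp add: norm_mult infsum_cmult_right' abs_mult)
  then show "(\<lambda>(i, j). f i * g j) summable_on I \<times> J"
    by (rule Infinite_Sum.abs_summable_summable)
qed

lemma majorized_mult:
  assumes "majorized a r N g" "majorized a r M h" "0 \<le> r"
  shows "majorized a r (N * M) (\<lambda>x. g x * h x)"
proof -
  obtain c \<alpha> s where s: "s \<le> N" "((\<lambda>n::nat. \<bar>c n\<bar> * r ^ multidegree (\<alpha> n)) has_sum s) UNIV"
    and e: "\<And>x. x\<in>cube a r \<Longrightarrow> ((\<lambda>i. c i * monomial (\<alpha> i) (x - a)) has_sum g x) UNIV"
    using assms(1) unfolding majorized_def expands_def by blast
  obtain d \<beta> t where t: "t \<le> M" "((\<lambda>n::nat. \<bar>d n\<bar> * r ^ multidegree (\<beta> n)) has_sum t) UNIV"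
    and e': "\<And>x. x\<in>cube a r \<Longrightarrow> ((\<lambda>i. d i * monomial (\<beta> i) (x - a)) has_sum h x) UNIV"
    using assms(2) unfolding majorized_def expands_def by blast
  have "0 \<le> s" "0 \<le> t"
    using s(2) t(2) assms(3) by (auto intro: has_sum_nonneg)
  then have "s * t \<le> N * M"
    using s(1) t(1) by (intro mult_mono) auto
  then have "expands (UNIV \<times> UNIV) (\<lambda>(i, j). c i * d j) (\<lambda>(i, j) b. \<alpha> i b + \<beta> j b) a r (N * M)
      (\<lambda>x. g x * h x)"
    using has_sum_times[OF s(2) t(2)] has_sum_times[OF e e']
    unfolding expands_def
    by (auto simp: case_prod_unfold multidegree_add monomial_add power_add abs_mult mult_ac)
  then show ?thesis
    by (intro expands_imp_majorized) auto
qed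

lemma majorized_add:
  assumes "majorized a r N g" "majorized a r M h"
  shows "majorized a r (N + M) (\<lambda>x. g x + h x)"
proof -
  obtain c \<alpha> s where s: "s \<le> N" "((\<lambda>n::nat. \<bar>c n\<bar> * r ^ multidegree (\<alpha> n)) has_sum s) UNIV"
    and e: "\<And>x. x\<in>cube a r \<Longrightarrow> ((\<lambda>i. c i * monomial (\<alpha> i) (x - a)) has_sum g x) UNIV"
    using assms(1) unfolding majorized_def expands_def by blast
  obtain d \<beta> t where t: "t \<le> M" "((\<lambda>n::nat. \<bar>d n\<bar> * r ^ multidegree (\<beta> n)) has_sum t) UNIV"
    and e': "\<And>x. x\<in>cube a r \<Longrightarrow> ((\<lambda>i. d i * monomial (\<beta> i) (x - a)) has_sum h x) UNIV"
    using assms(2) unfolding majorized_def expands_def by blast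
  have Plus: "(F has_sum (u + v)) (UNIV <+> UNIV)"
    if "((\<lambda>n. F (Inl n)) has_sum u) UNIV" "((\<lambda>n. F (Inr n)) has_sum v) UNIV"
    for F :: "nat + nat \<Rightarrow> real" and u v
    using that unfolding Plus_def
    by (intro has_sum_Un_disjoint) (auto simp: has_sum_reindex o_def)
  have "expands (UNIV <+> UNIV) (case_sum c d) (case_sum \<alpha> \<beta>) a r (N + M) (\<lambda>x. g x + h x)"
    unfolding expands_def
    by (intro conjI ballI exI[of _ "s + t"] Plus) (use s t e e' in auto)
  then show ?thesis
    by (rule expands_imp_majorized[rotated]) auto
qed

lemma majorized_sum:
  assumes "finite S" "\<And>i. i \<in> S \<Longrightarrow> majorized a r (N i) (g i)"
  shows "majorized a r (\<Sum>i\<in>S. N i) (\<lambda>x. \<Sum>i\<in>S. g i x)"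
  using assms
  by (induction S rule: finite_induct) (use majorized_const[of a r 0] in \<open>auto intro: majorized_add\<close>)

text \<open>
  Unconditional convergence of a real series is absolute convergence. Evaluated at the corner of a
  cube inside the ball of convergence, where every monomial is a power of the radius, it gives
  the norm.
\<close>

lemma real_analytic_imp_majorized:
  assumes "real_analytic_on g S" "a \<in> S"
  obtains r N where "r > 0" "majorized a r N g"
proof -
  obtain c r where r: "r > 0" and hs: "\<And>x. x\<in>ball a r \<Longrightarrow>
      ((\<lambda>\<alpha>. c \<alpha> * (\<Prod>b\<in>Basis. ((x - a) \<bullet> b) ^ \<alpha> b)) has_sum g x) (Basis \<rightarrow>\<^sub>E UNIV)"
    using assms unfolding real_analytic_on_def by blast
  let ?I = "(Basis :: 'a set) \<rightarrow>\<^sub>E (UNIV :: nat set)"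
  \<comment> \<open>If all coordinates are at most \<open>\<rho>\<close>, the norm in dimension \<open>d\<close> is at most \<open>d * \<rho>\<close>, which must be below \<open>r\<close>.\<close>
  define \<rho> where "\<rho> = r / (DIM('a) + 1)"
  have \<rho>: "\<rho> > 0" using r by (simp add: \<rho>_def)
  have small: "x \<in> ball a r" if "\<And>b. b \<in> Basis \<Longrightarrow> \<bar>(x - a) \<bullet> b\<bar> \<le> \<rho>" for x
  proof -
    have "norm (x - a) \<le> (\<Sum>b\<in>Basis. \<bar>(x - a) \<bullet> b\<bar>)"
      by (rule norm_le_l1)
    also have "\<dots> \<le> (\<Sum>b\<in>(Basis::'a set). \<rho>)"
      using that by (intro sum_mono)
    also have "\<dots> < r"
      using r by (simp add: \<rho>_def field_simps)
    finally show ?thesis by (simp add: dist_norm norm_minus_commute)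
  qed
  have "((\<lambda>\<alpha>. c \<alpha> * \<rho> ^ multidegree \<alpha>) has_sum g (a + \<rho> *\<^sub>R One)) ?I"
    using hs[OF small[of "a + \<rho> *\<^sub>R One"]] \<rho> by (simp add: multidegree_def power_sum)
  then have "(\<lambda>\<alpha>. norm (c \<alpha> * \<rho> ^ multidegree \<alpha>)) summable_on ?I"
    by (intro summable_on_iff_abs_summable_on_real[THEN iffD1] has_sum_imp_summable)
  then obtain N where N: "((\<lambda>\<alpha>. \<bar>c \<alpha>\<bar> * \<rho> ^ multidegree \<alpha>) has_sum N) ?I"
    using \<rho> by (auto simp: summable_on_def abs_mult)
  have "expands ?I c (\<lambda>\<alpha>. \<alpha>) a \<rho> N g"
    unfolding expands_def monomial_def
    by (intro conjI ballI exI[of _ N] hs small N) (auto simp: mem_cube less_imp_le)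
  then have "majorized a \<rho> N g"
    by (rule expands_imp_majorized[rotated]) (intro countable_PiE finite_Basis, auto)
  with \<rho> show ?thesis by (rule that)
qed

section \<open>Directional derivatives of power series\<close>

definition pd :: "'a::euclidean_space \<Rightarrow> ('a \<Rightarrow> real) \<Rightarrow> 'a \<Rightarrow> real" where
  "pd b g x = deriv (\<lambda>t. g (x + t *\<^sub>R b)) 0"

lemma pd_eq:
  assumes "(g has_derivative g') (at x)"
  shows "pd b g x = g' b"
proof -
  have lin: "((\<lambda>t. x + t *\<^sub>R b) has_derivative (\<lambda>t. t *\<^sub>R b)) (at 0)"
    by (auto intro!: derivative_eq_intros)
  have "((\<lambda>t. g (x + t *\<^sub>R b)) has_derivative (\<lambda>t. g' (t *\<^sub>R b))) (at 0)"
    by (rule has_derivative_compose[OF lin, of g]) (use assms in simp)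
  moreover have "(\<lambda>t. g' (t *\<^sub>R b)) = (*) (g' b)"
    using has_derivative_linear[OF assms] by (auto simp: linear_cmul)
  ultimately have "((\<lambda>t. g (x + t *\<^sub>R b)) has_field_derivative g' b) (at 0)"
    by (simp add: has_field_derivative_def)
  then show ?thesis
    unfolding pd_def by (rule DERIV_imp_deriv)
qed

lemma pd_cong:
  assumes "open S" "x \<in> S" "\<And>y. y \<in> S \<Longrightarrow> g y = h y"
  shows "pd b g x = pd b h x"
proof -
  have "((\<lambda>t. x + t *\<^sub>R b) \<longlongrightarrow> x + 0 *\<^sub>R b) (at 0)"
    by (intro tendsto_intros)
  then have "\<forall>\<^sub>F t in at 0. x + t *\<^sub>R b \<in> S"
    using assms(1,2) by (intro topological_tendstoD) auto
  then have "\<forall>\<^sub>F t in nhds 0. g (x + t *\<^sub>R b) = h (x + t *\<^sub>R b)"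
    using assms by (auto simp: eventually_nhds_conv_at elim: eventually_mono)
  then show ?thesis
    unfolding pd_def by (intro deriv_cong_ev) auto
qed

lemma cube_shrink:
  assumes "x \<in> cube a r"
  obtains r' where "0 < r'" "r' < r" "x \<in> cube a r'"
proof -
  define m where "m = Max ((\<lambda>b. \<bar>(x - a) \<bullet> b\<bar>) ` Basis)"
  have fin: "finite ((\<lambda>b. \<bar>(x - a) \<bullet> b\<bar>) ` (Basis::'a set))" "(\<lambda>b. \<bar>(x - a) \<bullet> b\<bar>) ` (Basis::'a set) \<noteq> {}"
    by auto
  have lt: "m < r"
    using Max_in[OF fin] assms by (auto simp: mem_cube m_def)
  have le: "\<bar>(x - a) \<bullet> b\<bar> \<le> m" if "b \<in> Basis" for b
    unfolding m_def using that by (intro Max_ge) auto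
  obtain b :: 'a where "b \<in> Basis"
    using nonempty_Basis by blast
  then have "0 \<le> m"
    using le[of b] abs_ge_zero[of "(x - a) \<bullet> b"] by linarith
  with lt have "0 < (m + r) / 2" "m < (m + r) / 2" "(m + r) / 2 < r"
    by (simp_all add: field_simps)
  with le show ?thesis
    by (intro that[of "(m + r) / 2"]) (auto simp only: mem_cube intro: le_less_trans)
qed

text \<open>
  This is the term-wise Cauchy estimate: the binomial expansion of \<open>(s + \<delta>)\<^sup>k\<close> contains the
  summand \<open>k s\<^bsup>k-1\<^esup> \<delta>\<close>.
\<close>

lemma power_pred_le_shift:
  fixes s \<delta> r :: real
  assumes "0 \<le> s" "0 \<le> \<delta>" "s + \<delta> \<le> r"
  shows "real k * s ^ (k - 1) * \<delta> \<le> r ^ k"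
proof -
  have "s ^ k + real k * s ^ (k - 1) * \<delta> \<le> (s + \<delta>) ^ k"
  proof (induction k)
    case (Suc k)
    have "s ^ Suc k + real (Suc k) * s ^ k * \<delta> \<le> (s + \<delta>) * (s ^ k + real k * s ^ (k - 1) * \<delta>)"
      using assms by (cases k) (auto simp: algebra_simps)
    also have "\<dots> \<le> (s + \<delta>) * (s + \<delta>) ^ k"
      using Suc assms by (intro mult_left_mono) auto
    finally show ?case by simp
  qed simp
  also have "\<dots> \<le> r ^ k"
    using assms by (intro power_mono) auto
  finally show ?thesis
    using assms(1) by (smt (verit) zero_le_power)
qed

lemma multidegree_lower:
  assumes "b \<in> Basis" "\<alpha> b \<noteq> 0"
  shows "multidegree (\<alpha>(b := \<alpha> b - 1)) = multidegree \<alpha> - 1"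
  using assms by (simp add: multidegree_def sum.remove[of _ b])

lemma coordinate_le_multidegree: "b \<in> Basis \<Longrightarrow> \<alpha> b \<le> multidegree \<alpha>"
  unfolding multidegree_def by (rule member_le_sum) auto

lemma lowered_term_bound:
  assumes "b \<in> Basis" "0 \<le> s" "0 < \<delta>" "s + \<delta> \<le> r"
  shows "\<bar>k * real (\<alpha> b)\<bar> * s ^ multidegree (\<alpha>(b := \<alpha> b - 1)) \<le> (\<bar>k\<bar> * r ^ multidegree \<alpha>) / \<delta>"
proof (cases "\<alpha> b = 0")
  case True
  then show ?thesis using assms by simp
next
  case False
  have "real (\<alpha> b) * s ^ (multidegree \<alpha> - 1) * \<delta> \<le> real (multidegree \<alpha>) * s ^ (multidegree \<alpha> - 1) * \<delta>"
    using coordinate_le_multidegree[of b \<alpha>] assms by (intro mult_right_mono) auto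
  also have "\<dots> \<le> r ^ multidegree \<alpha>"
    using assms by (intro power_pred_le_shift) auto
  finally have "\<bar>k\<bar> * (real (\<alpha> b) * s ^ (multidegree \<alpha> - 1) * \<delta>) \<le> \<bar>k\<bar> * r ^ multidegree \<alpha>"
    by (rule mult_left_mono) simp
  then show ?thesis
    using multidegree_lower[of b \<alpha>] assms(1,3) False by (simp add: abs_mult field_simps)
qed

lemma monomial_has_derivative:
  "(monomial \<alpha> has_derivative
     (\<lambda>h. \<Sum>b\<in>Basis. (h \<bullet> b) * (real (\<alpha> b) * monomial (\<alpha>(b := \<alpha> b - 1)) y))) (at y)"
proof -
  have lower: "monomial (\<alpha>(b := \<alpha> b - 1)) y = (y \<bullet> b) ^ (\<alpha> b - 1) * (\<Prod>j\<in>Basis - {b}. (y \<bullet> j) ^ \<alpha> j)"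
    if "b \<in> Basis" for b
    using that by (simp add: monomial_def prod.remove[of _ b])
  have "((\<lambda>y. \<Prod>b\<in>Basis. (y \<bullet> b) ^ \<alpha> b) has_derivative
      (\<lambda>h. \<Sum>b\<in>Basis. (of_nat (\<alpha> b) * (h \<bullet> b) * (y \<bullet> b) ^ (\<alpha> b - 1)) *
         (\<Prod>j\<in>Basis - {b}. (y \<bullet> j) ^ \<alpha> j))) (at y)"
    by (intro has_derivative_prod has_derivative_power has_derivative_inner_left has_derivative_ident)
  also have "(\<lambda>h. \<Sum>b\<in>Basis. (of_nat (\<alpha> b) * (h \<bullet> b) * (y \<bullet> b) ^ (\<alpha> b - 1)) *
         (\<Prod>j\<in>Basis - {b}. (y \<bullet> j) ^ \<alpha> j)) =
      (\<lambda>h. \<Sum>b\<in>Basis. (h \<bullet> b) * (real (\<alpha> b) * monomial (\<alpha>(b := \<alpha> b - 1)) y))"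
    by (intro ext sum.cong refl) (simp only: lower mult_ac)
  finally show ?thesis
    unfolding monomial_def[abs_def] .
qed

text \<open>
  Differentiation term by term: on a smaller cube, the series of the partial derivatives are
  dominated by the convergent series of the \<open>\<bar>c n\<bar> r\<^bsup>deg\<^esup> / (r - s)\<close>, hence converge uniformly.
\<close>

lemma expands_has_derivative:
  fixes c :: "nat \<Rightarrow> real"
  assumes g: "expands UNIV c \<alpha> a r N g" and x: "x \<in> cube a r"
  shows "(g has_derivative (\<lambda>h. \<Sum>b\<in>Basis. (h \<bullet> b) *
      (\<Sum>n. c n * real (\<alpha> n b) * monomial ((\<alpha> n)(b := \<alpha> n b - 1)) (x - a)))) (at x)"
proof -
  obtain s where s: "0 < s" "s < r" "x \<in> cube a s"
    using cube_shrink[OF x] .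
  define D where "D b n y = c n * real (\<alpha> n b) * monomial ((\<alpha> n)(b := \<alpha> n b - 1)) (y - a)" for b n y
  define G where "G b y = (\<Sum>n. D b n y)" for b y
  obtain S where S: "((\<lambda>n. \<bar>c n\<bar> * r ^ multidegree (\<alpha> n)) has_sum S) UNIV"
    using g unfolding expands_def by blast
  have sums: "(\<lambda>n. c n * monomial (\<alpha> n) (y - a)) sums g y" if "y \<in> cube a r" for y
    using g that unfolding expands_def by (intro has_sum_imp_sums) auto
  have summ: "summable (\<lambda>n. \<bar>c n\<bar> * r ^ multidegree (\<alpha> n) / (r - s))"
    using has_sum_imp_sums[OF S] by (intro summable_divide) (rule sums_summable)
  have D_bound: "norm (D b n y) \<le> \<bar>c n\<bar> * r ^ multidegree (\<alpha> n) / (r - s)"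
    if "b \<in> Basis" "y \<in> cube a s" for b n y
  proof -
    have "norm (D b n y) \<le> \<bar>c n * real (\<alpha> n b)\<bar> * s ^ multidegree ((\<alpha> n)(b := \<alpha> n b - 1))"
      unfolding D_def using that(2) by (auto simp: abs_mult intro!: mult_left_mono monomial_bound)
    also have "\<dots> \<le> \<bar>c n\<bar> * r ^ multidegree (\<alpha> n) / (r - s)"
      using that s by (intro lowered_term_bound) auto
    finally show ?thesis .
  qed
  have unif: "uniform_limit (cube a s) (\<lambda>n y. \<Sum>i<n. D b i y) (G b) sequentially" if "b \<in> Basis" for b
    unfolding G_def by (rule Weierstrass_m_test[OF D_bound[OF that] summ])
  have "\<exists>g'. \<forall>y\<in>cube a s. (\<lambda>n. c n * monomial (\<alpha> n) (y - a)) sums g' y \<and>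
      (g' has_derivative (\<lambda>h. \<Sum>b\<in>Basis. (h \<bullet> b) * G b y)) (at y within cube a s)"
  proof (rule has_derivative_series[where f' = "\<lambda>n y h. \<Sum>b\<in>Basis. (h \<bullet> b) * D b n y"])
    show "convex (cube a s)"
      by (simp add: cube_def convex_box)
    show "x \<in> cube a s" by (rule s)
    show "(\<lambda>n. c n * monomial (\<alpha> n) (x - a)) sums g x"
      by (rule sums[OF x])
  next
    fix n y
    have "((\<lambda>y. monomial (\<alpha> n) (y - a)) has_derivative (\<lambda>h. \<Sum>b\<in>Basis. (h \<bullet> b) *
        (real (\<alpha> n b) * monomial ((\<alpha> n)(b := \<alpha> n b - 1)) (y - a)))) (at y within cube a s)"
      by (rule has_derivative_compose[where f = "\<lambda>y. y - a" and f' = "\<lambda>h. h", OF _ monomial_has_derivative])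
        (auto intro!: derivative_eq_intros)
    then have "((\<lambda>y. c n * monomial (\<alpha> n) (y - a)) has_derivative (\<lambda>h. c n * (\<Sum>b\<in>Basis. (h \<bullet> b) *
        (real (\<alpha> n b) * monomial ((\<alpha> n)(b := \<alpha> n b - 1)) (y - a))))) (at y within cube a s)"
      by (rule has_derivative_mult_right)
    then show "((\<lambda>y. c n * monomial (\<alpha> n) (y - a)) has_derivative
        (\<lambda>h. \<Sum>b\<in>Basis. (h \<bullet> b) * D b n y)) (at y within cube a s)"
      by (simp add: D_def sum_distrib_left mult_ac)
  next
    fix e :: real assume "e > 0"
    then have e: "e / DIM('a) > 0" by simp
    have "\<forall>\<^sub>F n in sequentially. \<forall>b\<in>Basis. \<forall>y\<in>cube a s. dist (\<Sum>i<n. D b i y) (G b y) < e / DIM('a)"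
      using unif e by (intro eventually_ball_finite) (auto dest: uniform_limitD)
    then show "\<forall>\<^sub>F n in sequentially. \<forall>y\<in>cube a s. \<forall>h.
        norm ((\<Sum>i<n. \<Sum>b\<in>Basis. (h \<bullet> b) * D b i y) - (\<Sum>b\<in>Basis. (h \<bullet> b) * G b y)) \<le> e * norm h"
    proof eventually_elim
      case (elim n)
      show ?case
      proof (intro ballI allI)
        fix y h assume y: "y \<in> cube a s"
        have "(\<Sum>i<n. \<Sum>b\<in>Basis. (h \<bullet> b) * D b i y) - (\<Sum>b\<in>Basis. (h \<bullet> b) * G b y) =
            (\<Sum>b\<in>Basis. (h \<bullet> b) * ((\<Sum>i<n. D b i y) - G b y))"
          by (subst sum.swap) (simp add: sum_distrib_left right_diff_distrib sum_subtractf)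
        also have "norm \<dots> \<le> (\<Sum>b\<in>(Basis::'a set). norm h * (e / DIM('a)))"
        proof (rule sum_norm_le)
          fix b :: 'a assume b: "b \<in> Basis"
          have "\<bar>(\<Sum>i<n. D b i y) - G b y\<bar> \<le> e / DIM('a)"
            using elim b y by (auto simp: dist_real_def less_imp_le)
          then show "norm ((h \<bullet> b) * ((\<Sum>i<n. D b i y) - G b y)) \<le> norm h * (e / DIM('a))"
            unfolding real_norm_def abs_mult
            using Basis_le_norm[OF b, of h] by (intro mult_mono) auto
        qed
        also have "\<dots> = e * norm h" by simp
        finally show "norm ((\<Sum>i<n. \<Sum>b\<in>Basis. (h \<bullet> b) * D b i y) - (\<Sum>b\<in>Basis. (h \<bullet> b) * G b y))
            \<le> e * norm h" .
      qed
    qed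
  qed
  then obtain g' where g': "\<And>y. y \<in> cube a s \<Longrightarrow> (\<lambda>n. c n * monomial (\<alpha> n) (y - a)) sums g' y"
      "\<And>y. y \<in> cube a s \<Longrightarrow>
        (g' has_derivative (\<lambda>h. \<Sum>b\<in>Basis. (h \<bullet> b) * G b y)) (at y within cube a s)"
    by blast
  have "g' y = g y" if "y \<in> cube a s" for y
    using g'(1)[OF that] sums[of y] that cube_mono[of s r a] s by (auto intro: sums_unique2)
  then have "(g has_derivative (\<lambda>h. \<Sum>b\<in>Basis. (h \<bullet> b) * G b x)) (at x within cube a s)"
    using has_derivative_transform[OF s(3) _ g'(2)[OF s(3)], of g] by auto
  then show ?thesis
    using at_within_open[OF s(3) open_cube] by (simp add: G_def D_def)
qed

lemma sum_inner_Basis: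
  assumes "b \<in> Basis"
  shows "(\<Sum>b'\<in>Basis. (b \<bullet> b') * F b') = (F b :: real)"
proof -
  have "(\<Sum>b'\<in>Basis. (b \<bullet> b') * F b') = (\<Sum>b'\<in>Basis. if b = b' then F b' else 0)"
    using assms by (intro sum.cong) (auto simp: inner_Basis)
  then show ?thesis using assms by simp
qed

lemma expands_pd:
  fixes c :: "nat \<Rightarrow> real"
  assumes g: "expands UNIV c \<alpha> a r N g" and b: "b \<in> Basis"
    and s: "0 < s" "0 < \<delta>" "s + \<delta> \<le> r"
  shows "expands UNIV (\<lambda>n. c n * real (\<alpha> n b)) (\<lambda>n. (\<alpha> n)(b := \<alpha> n b - 1)) a s (N / \<delta>) (pd b g)"
proof -
  let ?w = "\<lambda>n. \<bar>c n * real (\<alpha> n b)\<bar> * s ^ multidegree ((\<alpha> n)(b := \<alpha> n b - 1))"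
  obtain S where S: "S \<le> N" "((\<lambda>n. \<bar>c n\<bar> * r ^ multidegree (\<alpha> n)) has_sum S) UNIV"
    using g unfolding expands_def by blast
  have S': "((\<lambda>n. \<bar>c n\<bar> * r ^ multidegree (\<alpha> n) / \<delta>) has_sum S / \<delta>) UNIV"
    using has_sum_cmult_left[OF S(2), of "1 / \<delta>"] by simp
  have le: "?w n \<le> \<bar>c n\<bar> * r ^ multidegree (\<alpha> n) / \<delta>" for n
    using b s by (intro lowered_term_bound) auto
  have w_on: "?w summable_on UNIV"
    by (rule summable_on_comparison_test[OF has_sum_imp_summable[OF S']]) (use le s in auto)
  then obtain S'' where S'': "(?w has_sum S'') UNIV"
    unfolding summable_on_def by blast
  have "S'' \<le> S / \<delta>"
    by (rule has_sum_mono[OF S'' S']) (rule le)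
  also have "\<dots> \<le> N / \<delta>"
    using S(1) s by (simp add: divide_right_mono)
  finally have bound: "S'' \<le> N / \<delta>" .
  have "((\<lambda>n. c n * real (\<alpha> n b) * monomial ((\<alpha> n)(b := \<alpha> n b - 1)) (x - a)) has_sum pd b g x) UNIV"
    if x: "x \<in> cube a s" for x
  proof -
    let ?D = "\<lambda>n. c n * real (\<alpha> n b) * monomial ((\<alpha> n)(b := \<alpha> n b - 1)) (x - a)"
    have xr: "x \<in> cube a r"
      using x cube_mono[of s r a] s by auto
    have "norm (?D n) \<le> ?w n" for n
      using x by (auto simp: abs_mult intro!: mult_left_mono monomial_bound)
    then have "summable (\<lambda>n. norm (?D n))"
      by (intro summable_comparison_test'[OF summable_on_imp_summable[OF w_on], of 0]) simp
    moreover have "pd b g x = (\<Sum>n. ?D n)"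
      by (simp only: pd_eq[OF expands_has_derivative[OF g xr]] sum_inner_Basis[OF b])
    ultimately show ?thesis
      by (simp add: norm_summable_imp_has_sum summable_norm_cancel summable_sums)
  qed
  then show ?thesis
    unfolding expands_def using S'' bound by blast
qed

text \<open>
  Cauchy's estimate: the radius given up pays for the exponents that differentiation puts in front
  of the monomials.
\<close>

lemma majorized_pd:
  assumes "majorized a r N g" "b \<in> Basis" "0 < s" "0 < \<delta>" "s + \<delta> \<le> r"
  shows "majorized a s (N / \<delta>) (pd b g)"
  using assms expands_pd unfolding majorized_def by blast

lemma majorized_has_derivative:
  assumes "majorized a r N g" "x \<in> cube a r"
  shows "(g has_derivative (\<lambda>h. \<Sum>b\<in>Basis. (h \<bullet> b) * pd b g x)) (at x)"
proof -
  obtain g' where g': "(g has_derivative g') (at x)"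
    using expands_has_derivative assms unfolding majorized_def by blast
  have "g' h = (\<Sum>b\<in>Basis. (h \<bullet> b) * pd b g x)" for h
  proof -
    have "g' h = g' (\<Sum>b\<in>Basis. (h \<bullet> b) *\<^sub>R b)"
      by (simp add: euclidean_representation)
    also have "\<dots> = (\<Sum>b\<in>Basis. (h \<bullet> b) * g' b)"
      using has_derivative_linear[OF g'] by (simp add: linear_sum linear_cmul)
    finally show ?thesis by (simp add: pd_eq[OF g'])
  qed
  then have "g' = (\<lambda>h. \<Sum>b\<in>Basis. (h \<bullet> b) * pd b g x)" by blast
  with g' show ?thesis by simp
qed

text \<open>
  Both mixed derivatives are sums of series with the same terms.
\<close>

lemma majorized_pd_commute:
  assumes g: "majorized a r N g" and x: "x \<in> cube a r" and b: "b \<in> Basis" "b' \<in> Basis"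
  shows "pd b (pd b' g) x = pd b' (pd b g) x"
proof -
  obtain c \<alpha> where e: "expands (UNIV :: nat set) c \<alpha> a r N g"
    using g unfolding majorized_def by blast
  obtain s where s: "0 < s" "s < r" "x \<in> cube a s"
    using cube_shrink[OF x] .
  define \<delta> where "\<delta> = (r - s) / 2"
  have \<delta>: "0 < \<delta>" "(s + \<delta>) + \<delta> \<le> r" "0 < s + \<delta>"
    using s by (auto simp: \<delta>_def field_simps)
  have "((\<lambda>n. c n * real (\<alpha> n b1) * real (((\<alpha> n)(b1 := \<alpha> n b1 - 1)) b2) *
      monomial (((\<alpha> n)(b1 := \<alpha> n b1 - 1))(b2 := ((\<alpha> n)(b1 := \<alpha> n b1 - 1)) b2 - 1)) (x - a))
      has_sum pd b2 (pd b1 g) x) UNIV" if "b1 \<in> Basis" "b2 \<in> Basis" for b1 b2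
    using expands_pd[OF expands_pd[OF e that(1) \<delta>(3,1,2)] that(2) s(1) \<delta>(1) order_refl] s(3)
    unfolding expands_def by blast
  note series = this
  show ?thesis
  proof (cases "b = b'")
    case False
    then have "(\<alpha> n)(b := \<alpha> n b - 1, b' := \<alpha> n b' - 1) = (\<alpha> n)(b' := \<alpha> n b' - 1, b := \<alpha> n b - 1)" for n
      by (rule fun_upd_twist)
    with False show ?thesis
      using has_sum_unique[OF series[OF b] ] series[OF b(2,1)] by (simp add: mult_ac)
  qed simp
qed

section \<open>Iterated Lie derivatives\<close>

definition lieD :: "('a::euclidean_space \<Rightarrow> 'a) \<Rightarrow> ('a \<Rightarrow> real) \<Rightarrow> 'a \<Rightarrow> real" where
  "lieD V g x = (\<Sum>b\<in>Basis. (V x \<bullet> b) * pd b g x)"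

lemma majorized_lieD:
  fixes a :: "'a::euclidean_space" and M :: real
  assumes V: "\<And>b. b \<in> Basis \<Longrightarrow> majorized a s M (\<lambda>x. V x \<bullet> b)"
    and g: "majorized a r N g" and s: "0 < s" "0 < \<delta>" "s + \<delta> \<le> r"
  shows "majorized a s (DIM('a) * M / \<delta> * N) (lieD V g)"
proof -
  have "majorized a s (\<Sum>b\<in>(Basis::'a set). M * (N / \<delta>)) (\<lambda>x. \<Sum>b\<in>Basis. (V x \<bullet> b) * pd b g x)"
    by (intro majorized_sum majorized_mult V majorized_pd[OF g _ s]) (use s in auto)
  then show ?thesis
    by (simp add: lieD_def[abs_def] mult_ac)
qed

text \<open>
  Each of the \<open>n\<close> derivations may use up \<open>\<delta> = R / (2 n)\<close> of the radius, and then costs a factor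
  proportional to \<open>1/\<delta>\<close>, that is to \<open>n\<close>.
\<close>

lemma majorized_lieD_power:
  fixes a :: "'a::euclidean_space" and M :: real
  assumes V: "\<And>b. b \<in> Basis \<Longrightarrow> majorized a R M (\<lambda>x. V x \<bullet> b)"
    and f: "majorized a R N f" and R: "0 < R"
  shows "majorized a (R / 2) ((2 * DIM('a) * M * n / R) ^ n * N) ((lieD V ^^ n) f)"
proof (cases "n = 0")
  case True
  then show ?thesis
    using majorized_weaken[OF f, of "R / 2" N] R by simp
next
  case False
  define \<delta> where "\<delta> = R / (2 * n)"
  have \<delta>: "0 < \<delta>" and n\<delta>: "n * \<delta> = R / 2"
    using False R by (simp_all add: \<delta>_def)
  have "majorized a (R - j * \<delta>) ((DIM('a) * M / \<delta>) ^ j * N) ((lieD V ^^ j) f)" if "j \<le> n" for j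
    using that
  proof (induction j)
    case 0
    then show ?case using f by simp
  next
    case (Suc j)
    have "Suc j * \<delta> \<le> n * \<delta>"
      using Suc.prems \<delta> by (intro mult_right_mono) auto
    then have pos: "0 < R - Suc j * \<delta>"
      using n\<delta> R by linarith
    have "majorized a (R - Suc j * \<delta>) (DIM('a) * M / \<delta> * ((DIM('a) * M / \<delta>) ^ j * N))
        (lieD V ((lieD V ^^ j) f))"
    proof (rule majorized_lieD[where r = "R - j * \<delta>" and \<delta> = \<delta>])
      show "majorized a (R - Suc j * \<delta>) M (\<lambda>x. V x \<bullet> b)" if "b \<in> Basis" for b
        by (rule majorized_weaken[OF V[OF that]]) (use pos \<delta> in auto)
    qed (use Suc pos \<delta> in \<open>auto simp: algebra_simps\<close>)
    then show ?case by (simp add: mult_ac)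
  qed
  from this[OF order_refl] have
    "majorized a (R / 2) ((DIM('a) * M / \<delta>) ^ n * N) ((lieD V ^^ n) f)"
    by (simp add: n\<delta>)
  then show ?thesis
    by (simp add: \<delta>_def mult_ac)
qed

section \<open>Lie series along a trajectory\<close>

text \<open>
  At the first time outside the cube the trajectory has moved by at most \<open>M t\<close> in each coordinate,
  because the speed was bounded until then; this is not enough to reach the boundary.
\<close>

lemma trajectory_in_cube_forward:
  fixes \<gamma> :: "real \<Rightarrow> 'a::euclidean_space"
  assumes t: "0 \<le> t" and M: "0 \<le> M"
    and deriv: "\<And>s. 0 \<le> s \<Longrightarrow> s \<le> t \<Longrightarrow> (\<gamma> has_vector_derivative v s) (at s)"
    and bound: "\<And>s b. 0 \<le> s \<Longrightarrow> s \<le> t \<Longrightarrow> \<gamma> s \<in> cube a r \<Longrightarrow> b \<in> Basis \<Longrightarrow> \<bar>v s \<bullet> b\<bar> \<le> M"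
    and start: "\<gamma> 0 \<in> cube a r0" and room: "r0 + M * t \<le> r"
  shows "\<gamma> t \<in> cube a r"
proof (rule ccontr)
  assume out: "\<gamma> t \<notin> cube a r"
  \<comment> \<open>The set of exit times is closed, so it has a least element \<open>u\<close>.\<close>
  define S where "S = {0..t} \<inter> \<gamma> -` (- cube a r)"
  define u where "u = Inf S"
  have "continuous_on {0..t} \<gamma>"
    using deriv by (intro continuous_at_imp_continuous_on ballI has_vector_derivative_continuous) auto
  then have "closed S"
    unfolding S_def using open_cube by (intro continuous_closed_preimage) auto
  moreover have "S \<noteq> {}"
    using out t by (auto simp: S_def)
  moreover have bdd: "bdd_below S"
    by (rule bdd_belowI[of _ 0]) (auto simp: S_def)
  ultimately have "u \<in> S"
    unfolding u_def by (intro closed_contains_Inf)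
  then have u: "0 \<le> u" "u \<le> t" "\<gamma> u \<notin> cube a r"
    by (auto simp: S_def)
  have before: "\<gamma> s \<in> cube a r" if "0 < s" "s < u" for s
  proof (rule ccontr)
    assume "\<gamma> s \<notin> cube a r"
    with that u have "s \<in> S" by (auto simp: S_def)
    then have "u \<le> s" unfolding u_def using bdd by (rule cInf_lower)
    with that show False by simp
  qed
  have "\<bar>(\<gamma> u - a) \<bullet> b\<bar> < r" if b: "b \<in> Basis" for b
  proof -
    have d: "((\<lambda>s. (\<gamma> s - a) \<bullet> b) has_real_derivative v s \<bullet> b) (at s)" if "0 \<le> s" "s \<le> u" for s
      using deriv[of s] that u unfolding has_vector_derivative_def has_field_derivative_def
      by (auto intro!: derivative_eq_intros simp: fun_eq_iff)
    have "\<bar>(\<gamma> u - a) \<bullet> b - (\<gamma> 0 - a) \<bullet> b\<bar> \<le> M * u"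
    proof (cases "u = 0")
      case False
      then have "0 < u" using u by simp
      then obtain s where s: "0 < s" "s < u"
          "(\<gamma> u - a) \<bullet> b - (\<gamma> 0 - a) \<bullet> b = (u - 0) * (v s \<bullet> b)"
        using MVT2[of 0 u "\<lambda>s. (\<gamma> s - a) \<bullet> b" "\<lambda>s. v s \<bullet> b"] d by auto
      then show ?thesis
        using bound[of s b] before[of s] u b
        by (simp add: abs_mult mult.commute[of u] mult_right_mono)
    qed simp
    moreover have "M * u \<le> M * t"
      using M u by (intro mult_left_mono)
    moreover have "\<bar>(\<gamma> 0 - a) \<bullet> b\<bar> < r0"
      using start b by (simp add: mem_cube)
    ultimately show ?thesis using room by linarith
  qed
  with u(3) show False by (simp add: mem_cube)
qed

lemma trajectory_in_cube:
  fixes \<gamma> :: "real \<Rightarrow> 'a::euclidean_space"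
  assumes M: "0 \<le> M"
    and deriv: "\<And>s. \<bar>s\<bar> \<le> \<bar>t\<bar> \<Longrightarrow> (\<gamma> has_vector_derivative v s) (at s)"
    and bound: "\<And>s b. \<gamma> s \<in> cube a r \<Longrightarrow> b \<in> Basis \<Longrightarrow> \<bar>v s \<bullet> b\<bar> \<le> M"
    and start: "\<gamma> 0 \<in> cube a r0" and room: "r0 + M * \<bar>t\<bar> \<le> r"
  shows "\<gamma> t \<in> cube a r"
proof (cases "0 \<le> t")
  case True
  then show ?thesis
    using trajectory_in_cube_forward[of t M \<gamma> v a r r0] assms by auto
next
  case False
  have "((\<lambda>s. \<gamma> (- s)) has_vector_derivative - v (- s)) (at s)" if "0 \<le> s" "s \<le> - t" for s
  proof -
    have "(uminus has_vector_derivative (- 1 :: real)) (at s)"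
      by (auto intro!: derivative_eq_intros)
    then show ?thesis
      using vector_diff_chain_at[of uminus "-1" s \<gamma> "v (- s)"] deriv[of "- s"] that
      by (simp add: o_def)
  qed
  then have "(\<lambda>s. \<gamma> (- s)) (- t) \<in> cube a r"
    using False assms
    by (intro trajectory_in_cube_forward[of "- t" M "\<lambda>s. \<gamma> (- s)" "\<lambda>s. - v (- s)" a r r0]) auto
  then show ?thesis by simp
qed

lemma DERIV_along_trajectory:
  assumes g: "majorized a r N g" and x: "\<gamma> t \<in> cube a r"
    and \<gamma>: "(\<gamma> has_vector_derivative V (\<gamma> t)) (at t)"
  shows "((\<lambda>t. g (\<gamma> t)) has_real_derivative lieD V g (\<gamma> t)) (at t)"
proof -
  have "((\<lambda>t. g (\<gamma> t)) has_derivative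
      (\<lambda>h. \<Sum>b\<in>Basis. ((h *\<^sub>R V (\<gamma> t)) \<bullet> b) * pd b g (\<gamma> t))) (at t)"
    using \<gamma> unfolding has_vector_derivative_def
    by (rule has_derivative_compose[where f = \<gamma> and g = g and x = t, OF _ majorized_has_derivative[OF g x]])
  also have "(\<lambda>h. \<Sum>b\<in>Basis. ((h *\<^sub>R V (\<gamma> t)) \<bullet> b) * pd b g (\<gamma> t)) = (*) (lieD V g (\<gamma> t))"
    by (auto simp: lieD_def sum_distrib_right sum_distrib_left mult_ac)
  finally show ?thesis
    unfolding has_field_derivative_def .
qed

lemma power_self_le_fact_exp: "real n ^ n \<le> fact n * exp 1 ^ n"
proof -
  have "real n ^ n /\<^sub>R fact n \<le> (\<Sum>k. real n ^ k /\<^sub>R fact k)"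
    using sum_le_suminf[OF summable_exp_generic[of "real n"], of "{n}"] by simp
  also have "\<dots> = exp (real n)"
    by (simp only: exp_def)
  also have "\<dots> = exp 1 ^ n"
    using exp_of_nat_mult[of n "1::real"] by simp
  finally show ?thesis
    by (simp add: field_simps)
qed

text \<open>
  The two smallness conditions on \<open>\<epsilon>\<close> have different sources: the first keeps the trajectory inside
  the cube of radius \<open>R / 2\<close>, where the iterated Lie derivatives are bounded; the second makes the
  resulting geometric bound on the Lagrange remainder tend to zero.
\<close>

theorem lie_series_sums_along_trajectory:
  fixes a :: "'a::euclidean_space" and V :: "'a \<Rightarrow> 'a" and M :: real
  assumes V: "\<And>b. b \<in> Basis \<Longrightarrow> majorized a R M (\<lambda>x. V x \<bullet> b)"
    and f: "majorized a R N f" and R: "0 < R" and M: "0 < M"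
    and start: "\<gamma> 0 \<in> cube a (R / 4)"
    and small: "\<bar>\<epsilon>\<bar> < R / (4 * M)" "\<bar>\<epsilon>\<bar> < R / (2 * DIM('a) * M * exp 1)"
    and \<gamma>: "\<And>t. \<bar>t\<bar> \<le> \<bar>\<epsilon>\<bar> \<Longrightarrow> (\<gamma> has_vector_derivative V (\<gamma> t)) (at t)"
  shows "(\<lambda>n. \<epsilon> ^ n / fact n * (lieD V ^^ n) f (\<gamma> 0)) sums f (\<gamma> \<epsilon>)"
proof -
  define K where "K = 2 * DIM('a) * M / R"
  have inside: "\<gamma> t \<in> cube a (R / 2)" if "\<bar>t\<bar> \<le> \<bar>\<epsilon>\<bar>" for t
  proof (rule trajectory_in_cube[of M t \<gamma> "\<lambda>s. V (\<gamma> s)" a "R / 2" "R / 4"])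
    show "\<bar>V (\<gamma> s) \<bullet> b\<bar> \<le> M" if "\<gamma> s \<in> cube a (R / 2)" "b \<in> Basis" for s b
      using majorized_bound[OF V[OF that(2)], of "\<gamma> s"] that cube_mono[of "R / 2" R a] R by auto
    have "M * \<bar>t\<bar> \<le> R / 4"
      using that small(1) M mult_left_mono[of "\<bar>t\<bar>" "R / (4 * M)" M] by simp
    then show "R / 4 + M * \<bar>t\<bar> \<le> R / 2" by simp
  qed (use that M start \<gamma> in auto)
  have maj: "majorized a (R / 2) ((K * n) ^ n * N) ((lieD V ^^ n) f)" for n
    using majorized_lieD_power[OF V f R, of n] by (simp add: K_def)
  have remainder: "norm (f (\<gamma> \<epsilon>) - (\<Sum>m<n. \<epsilon> ^ m / fact m * (lieD V ^^ m) f (\<gamma> 0)))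
      \<le> (K * exp 1 * \<bar>\<epsilon>\<bar>) ^ n * N" for n
  proof -
    have "\<forall>m t. m < n \<and> \<bar>t\<bar> \<le> \<bar>\<epsilon>\<bar> \<longrightarrow>
        ((\<lambda>t. (lieD V ^^ m) f (\<gamma> t)) has_real_derivative (lieD V ^^ Suc m) f (\<gamma> t)) (at t)"
      using DERIV_along_trajectory[where \<gamma> = \<gamma> and V = V, OF maj inside \<gamma>] by simp
    then obtain t where t: "\<bar>t\<bar> \<le> \<bar>\<epsilon>\<bar>" and eq: "f (\<gamma> \<epsilon>) =
        (\<Sum>m<n. (lieD V ^^ m) f (\<gamma> 0) / fact m * \<epsilon> ^ m) + (lieD V ^^ n) f (\<gamma> t) / fact n * \<epsilon> ^ n"
      using Maclaurin_bi_le[of "\<lambda>m t. (lieD V ^^ m) f (\<gamma> t)" "\<lambda>t. f (\<gamma> t)" n \<epsilon>] by auto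
    have "norm (f (\<gamma> \<epsilon>) - (\<Sum>m<n. \<epsilon> ^ m / fact m * (lieD V ^^ m) f (\<gamma> 0))) =
        \<bar>(lieD V ^^ n) f (\<gamma> t)\<bar> * (\<bar>\<epsilon>\<bar> ^ n / fact n)"
      by (simp add: eq mult_ac abs_mult power_abs)
    also have "\<dots> \<le> (K * n) ^ n * N * (\<bar>\<epsilon>\<bar> ^ n / fact n)"
      by (intro mult_right_mono majorized_bound[OF maj inside[OF t]]) auto
    also have "\<dots> = K ^ n * \<bar>\<epsilon>\<bar> ^ n * N * (real n ^ n / fact n)"
      by (simp add: power_mult_distrib)
    also have "\<dots> \<le> K ^ n * \<bar>\<epsilon>\<bar> ^ n * N * exp 1 ^ n"
      using majorized_nonneg[OF f] R M power_self_le_fact_exp[of n]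
      by (intro mult_left_mono mult_nonneg_nonneg) (auto simp: K_def field_simps)
    finally show ?thesis
      by (simp add: power_mult_distrib mult_ac)
  qed
  have "K * exp 1 * \<bar>\<epsilon>\<bar> < 1"
    using small(2) R M by (simp add: K_def field_simps)
  then have "(\<lambda>n. (K * exp 1 * \<bar>\<epsilon>\<bar>) ^ n * N) \<longlonglongrightarrow> 0"
    using R M by (intro tendsto_mult_left_zero LIMSEQ_power_zero) (auto simp: K_def)
  then have "(\<lambda>n. f (\<gamma> \<epsilon>) - (\<Sum>m<n. \<epsilon> ^ m / fact m * (lieD V ^^ m) f (\<gamma> 0))) \<longlonglongrightarrow> 0"
    by (rule Lim_null_comparison[rotated]) (use remainder in auto)
  then have "(\<lambda>n. f (\<gamma> \<epsilon>) - (f (\<gamma> \<epsilon>) - (\<Sum>m<n. \<epsilon> ^ m / fact m * (lieD V ^^ m) f (\<gamma> 0))))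
      \<longlonglongrightarrow> f (\<gamma> \<epsilon>) - 0"
    by (intro tendsto_diff tendsto_const)
  then show ?thesis
    by (simp add: sums_def)
qed

section \<open>Calculus of functions analytic on an open cube\<close>

text \<open>
  For identities between derivatives the norms do not matter. Asking for a norm on each smaller cube
  gives a class that is closed under differentiation without loss of radius.
\<close>

definition power_series_on_cube :: "'a::euclidean_space \<Rightarrow> real \<Rightarrow> ('a \<Rightarrow> real) \<Rightarrow> bool" where
  "power_series_on_cube a r g \<longleftrightarrow> (\<forall>s. 0 < s \<longrightarrow> s < r \<longrightarrow> (\<exists>N. majorized a s N g))"

lemma power_series_on_cubeD:
  assumes "power_series_on_cube a r g" "0 < s" "s < r"
  obtains N where "majorized a s N g"
  using assms unfolding power_series_on_cube_def by blast

lemma majorized_imp_power_series_on_cube: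
  assumes "majorized a r N g"
  shows "power_series_on_cube a r g"
  unfolding power_series_on_cube_def
  using majorized_weaken[OF assms _ _ order_refl] by (auto intro: less_imp_le)

lemma power_series_on_cube_mult:
  assumes "power_series_on_cube a r g" "power_series_on_cube a r h"
  shows "power_series_on_cube a r (\<lambda>x. g x * h x)"
  unfolding power_series_on_cube_def
proof (intro allI impI)
  fix s assume s: "0 < s" "s < r"
  obtain N M where "majorized a s N g" "majorized a s M h"
    using power_series_on_cubeD[OF assms(1) s] power_series_on_cubeD[OF assms(2) s] by metis
  from majorized_mult[OF this] s show "\<exists>N. majorized a s N (\<lambda>x. g x * h x)"
    by auto
qed

lemma power_series_on_cube_cmult:
  assumes "power_series_on_cube a r g"
  shows "power_series_on_cube a r (\<lambda>x. k * g x)"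
  using majorized_const[of a r k, THEN majorized_imp_power_series_on_cube] assms
  by (rule power_series_on_cube_mult)

lemma power_series_on_cube_sum:
  assumes "finite I" "\<And>i. i \<in> I \<Longrightarrow> power_series_on_cube a r (g i)"
  shows "power_series_on_cube a r (\<lambda>x. \<Sum>i\<in>I. g i x)"
  unfolding power_series_on_cube_def
proof (intro allI impI)
  fix s assume "0 < s" "s < r"
  then have "\<forall>i\<in>I. \<exists>N. majorized a s N (g i)"
    using assms(2) unfolding power_series_on_cube_def by blast
  then obtain N where "\<forall>i\<in>I. majorized a s (N i) (g i)"
    by metis
  then show "\<exists>N. majorized a s N (\<lambda>x. \<Sum>i\<in>I. g i x)"
    using majorized_sum[OF assms(1), of a s N g] by blast
qed

lemma power_series_on_cube_diff:
  assumes "power_series_on_cube a r g" "power_series_on_cube a r h"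
  shows "power_series_on_cube a r (\<lambda>x. g x - h x)"
  unfolding power_series_on_cube_def
proof (intro allI impI)
  fix s assume s: "0 < s" "s < r"
  obtain N M where "majorized a s N g" "majorized a s M (\<lambda>x. (- 1) * h x)"
    using power_series_on_cubeD[OF assms(1) s]
      power_series_on_cubeD[OF power_series_on_cube_cmult[OF assms(2), of "- 1"] s] by metis
  from majorized_add[OF this] show "\<exists>N. majorized a s N (\<lambda>x. g x - h x)"
    by auto
qed

lemma power_series_on_cube_pd:
  assumes "power_series_on_cube a r g" "b \<in> Basis"
  shows "power_series_on_cube a r (pd b g)"
  unfolding power_series_on_cube_def
proof (intro allI impI)
  fix s assume s: "0 < s" "s < r"
  define t where "t = (s + r) / 2"
  have t: "0 < t" "t < r" "0 < t - s" "s + (t - s) \<le> t"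
    using s by (auto simp: t_def field_simps)
  then obtain N where "majorized a t N g"
    using assms(1) unfolding power_series_on_cube_def by blast
  from majorized_pd[OF this assms(2) s(1) t(3,4)] show "\<exists>N. majorized a s N (pd b g)"
    by blast
qed

lemma power_series_on_cube_pd_funpow:
  assumes "power_series_on_cube a r g" "b \<in> Basis"
  shows "power_series_on_cube a r ((pd b ^^ n) g)"
  by (induction n) (use assms power_series_on_cube_pd in auto)

lemma power_series_on_cube_has_derivative:
  assumes "power_series_on_cube a r g" "x \<in> cube a r"
  shows "(g has_derivative (\<lambda>h. pd h g x)) (at x)"
proof -
  obtain s where s: "0 < s" "s < r" "x \<in> cube a s"
    using cube_shrink[OF assms(2)] .
  obtain N where "majorized a s N g"
    using power_series_on_cubeD[OF assms(1) s(1,2)] .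
  from majorized_has_derivative[OF this s(3)] show ?thesis
    using pd_eq by (metis (no_types, lifting) ext)
qed

lemma pd_commute:
  assumes "power_series_on_cube a r g" "x \<in> cube a r" "b \<in> Basis" "b' \<in> Basis"
  shows "pd b (pd b' g) x = pd b' (pd b g) x"
proof -
  obtain s where s: "0 < s" "s < r" "x \<in> cube a s"
    using cube_shrink[OF assms(2)] .
  obtain N where "majorized a s N g"
    using power_series_on_cubeD[OF assms(1) s(1,2)] .
  from majorized_pd_commute[OF this s(3) assms(3,4)] show ?thesis .
qed

lemma pd_diff:
  assumes "power_series_on_cube a r g" "power_series_on_cube a r h" "x \<in> cube a r"
  shows "pd b (\<lambda>x. g x - h x) x = pd b g x - pd b h x"
  using pd_eq[OF has_derivative_diff[OF assms(1,2)[THEN power_series_on_cube_has_derivative, OF assms(3)]]] .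

lemma pd_cmult:
  assumes "power_series_on_cube a r g" "x \<in> cube a r"
  shows "pd b (\<lambda>x. k * g x) x = k * pd b g x"
  by (rule pd_eq[OF has_derivative_mult_right[OF power_series_on_cube_has_derivative[OF assms]]])

lemma pd_sum:
  assumes "\<And>i. i \<in> I \<Longrightarrow> power_series_on_cube a r (g i)" "x \<in> cube a r"
  shows "pd b (\<lambda>x. \<Sum>i\<in>I. g i x) x = (\<Sum>i\<in>I. pd b (g i) x)"
  by (rule pd_eq[OF has_derivative_sum], rule power_series_on_cube_has_derivative[OF assms])

lemma pd_mult:
  assumes "power_series_on_cube a r g" "power_series_on_cube a r h" "x \<in> cube a r"
  shows "pd b (\<lambda>x. g x * h x) x = g x * pd b h x + pd b g x * h x"
  using pd_eq[OF has_derivative_mult[OF assms(1,2)[THEN power_series_on_cube_has_derivative, OF assms(3)]]] .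

lemma pd_cong_cube:
  assumes "x \<in> cube a r" "\<And>y. y \<in> cube a r \<Longrightarrow> g y = h y"
  shows "pd b g x = pd b h x"
  by (rule pd_cong[OF open_cube assms])

lemma pd_funpow_sum:
  assumes "finite I" "\<And>i. i \<in> I \<Longrightarrow> power_series_on_cube a r (g i)" "b \<in> Basis" "x \<in> cube a r"
  shows "(pd b ^^ n) (\<lambda>x. \<Sum>i\<in>I. g i x) x = (\<Sum>i\<in>I. (pd b ^^ n) (g i) x)"
  using assms(4)
proof (induction n arbitrary: x)
  case (Suc n)
  have "(pd b ^^ Suc n) (\<lambda>x. \<Sum>i\<in>I. g i x) x = pd b (\<lambda>x. \<Sum>i\<in>I. (pd b ^^ n) (g i) x) x"
    using pd_cong_cube[OF Suc.prems Suc.IH] by simp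
  also have "\<dots> = (\<Sum>i\<in>I. (pd b ^^ Suc n) (g i) x)"
    using pd_sum[of I a r "\<lambda>i. (pd b ^^ n) (g i)"] assms Suc.prems
    by (simp add: power_series_on_cube_pd_funpow)
  finally show ?case .
qed simp

lemma pd_funpow_diff:
  assumes "power_series_on_cube a r g" "power_series_on_cube a r h" "b \<in> Basis" "x \<in> cube a r"
  shows "(pd b ^^ n) (\<lambda>x. g x - h x) x = (pd b ^^ n) g x - (pd b ^^ n) h x"
  using assms(4)
proof (induction n arbitrary: x)
  case (Suc n)
  have "(pd b ^^ Suc n) (\<lambda>x. g x - h x) x = pd b (\<lambda>x. (pd b ^^ n) g x - (pd b ^^ n) h x) x"
    using pd_cong_cube[OF Suc.prems Suc.IH] by simp
  also have "\<dots> = (pd b ^^ Suc n) g x - (pd b ^^ Suc n) h x"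
    using pd_diff[of a r "(pd b ^^ n) g" "(pd b ^^ n) h"] assms Suc.prems
    by (simp add: power_series_on_cube_pd_funpow)
  finally show ?case .
qed simp

lemma pd_funpow_commute:
  assumes "power_series_on_cube a r g" "b \<in> Basis" "b' \<in> Basis" "x \<in> cube a r"
  shows "(pd b ^^ n) (pd b' g) x = pd b' ((pd b ^^ n) g) x"
  using assms(4)
proof (induction n arbitrary: x)
  case (Suc n)
  have "(pd b ^^ Suc n) (pd b' g) x = pd b (pd b' ((pd b ^^ n) g)) x"
    using pd_cong_cube[OF Suc.prems Suc.IH] by simp
  also have "\<dots> = pd b' ((pd b ^^ Suc n) g) x"
    using pd_commute[of a r "(pd b ^^ n) g" x b b'] assms Suc.prems
    by (simp add: power_series_on_cube_pd_funpow)
  finally show ?case .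
qed simp

text \<open>
  Pascal's rule, in the form needed for the induction step of the Leibniz rule.
\<close>

lemma binomial_sum_Suc:
  fixes G H :: "nat \<Rightarrow> real"
  shows "(\<Sum>m\<le>n. real (n choose m) * (G (Suc (n - m)) * H m + G (n - m) * H (Suc m))) =
    (\<Sum>m\<le>Suc n. real (Suc n choose m) * (G (Suc n - m) * H m))"
proof -
  have "(\<Sum>m\<le>Suc n. real (Suc n choose m) * (G (Suc n - m) * H m)) =
      G (Suc n) * H 0 + (\<Sum>m\<le>n. real (n choose m) * (G (n - m) * H (Suc m))) +
      (\<Sum>m\<le>n. real (n choose Suc m) * (G (n - m) * H (Suc m)))"
    by (subst sum.atMost_Suc_shift) (simp add: sum.distrib algebra_simps)
  also have "G (Suc n) * H 0 + (\<Sum>m\<le>n. real (n choose m) * (G (n - m) * H (Suc m))) +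
      (\<Sum>m\<le>n. real (n choose Suc m) * (G (n - m) * H (Suc m))) =
      (\<Sum>m\<le>n. real (n choose m) * (G (n - m) * H (Suc m))) +
      (\<Sum>m\<le>Suc n. real (n choose m) * (G (Suc n - m) * H m))"
    by (subst sum.atMost_Suc_shift) simp
  also have "(\<Sum>m\<le>Suc n. real (n choose m) * (G (Suc n - m) * H m)) =
      (\<Sum>m\<le>n. real (n choose m) * (G (Suc (n - m)) * H m))"
    by (simp add: Suc_diff_le)
  finally show ?thesis
    by (simp add: sum.distrib algebra_simps)
qed

lemma pd_funpow_mult:
  assumes g: "power_series_on_cube a r g" and h: "power_series_on_cube a r h"
    and b: "b \<in> Basis" and x: "x \<in> cube a r"
  shows "(pd b ^^ n) (\<lambda>x. g x * h x) x =
    (\<Sum>m\<le>n. real (n choose m) * ((pd b ^^ (n - m)) g x * (pd b ^^ m) h x))"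
  using x
proof (induction n arbitrary: x)
  case (Suc n)
  let ?G = "\<lambda>k. (pd b ^^ k) g" and ?H = "\<lambda>k. (pd b ^^ k) h"
  have ps: "power_series_on_cube a r (?G k)" "power_series_on_cube a r (?H k)" for k
    using g h b by (auto intro: power_series_on_cube_pd_funpow)
  have "(pd b ^^ Suc n) (\<lambda>x. g x * h x) x =
      pd b (\<lambda>x. \<Sum>m\<le>n. real (n choose m) * (?G (n - m) x * ?H m x)) x"
    using pd_cong_cube[OF Suc.prems Suc.IH] by simp
  also have "\<dots> = (\<Sum>m\<le>n. pd b (\<lambda>x. real (n choose m) * (?G (n - m) x * ?H m x)) x)"
    by (rule pd_sum[OF power_series_on_cube_cmult[OF power_series_on_cube_mult[OF ps]] Suc.prems])
  also have "\<dots> = (\<Sum>m\<le>n. real (n choose m) *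
      (?G (Suc (n - m)) x * ?H m x + ?G (n - m) x * ?H (Suc m) x))"
    using pd_cmult[OF power_series_on_cube_mult[OF ps] Suc.prems] pd_mult[OF ps Suc.prems]
    by (simp add: add.commute)
  also have "\<dots> = (\<Sum>m\<le>Suc n. real (Suc n choose m) * (?G (Suc n - m) x * ?H m x))"
    by (rule binomial_sum_Suc[of n "\<lambda>k. ?G k x" "\<lambda>k. ?H k x"])
  finally show ?case .
qed simp

section \<open>Taylor coefficients as iterated derivatives\<close>

lemma pd_power_series:
  fixes g :: "'a::euclidean_space \<Rightarrow> real"
  assumes g: "\<And>t. \<bar>t\<bar> < r \<Longrightarrow> (\<lambda>m. c m * t ^ m) sums g (x + t *\<^sub>R b)" and t: "\<bar>t\<bar> < r"
  shows "(\<lambda>m. diffs c m * t ^ m) sums pd b g (x + t *\<^sub>R b)"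
proof -
  let ?\<phi> = "\<lambda>s. \<Sum>m. c m * s ^ m"
  have summ: "summable (\<lambda>m. c m * s ^ m)" if "norm s < r" for s
    using g[of s] that by (auto simp: sums_iff)
  have "(?\<phi> has_field_derivative (\<Sum>m. diffs c m * t ^ m)) (at (0 + t))"
    using termdiffs_strong'[of r c t] summ t by simp
  then have "((\<lambda>s. ?\<phi> (s + t)) has_field_derivative (\<Sum>m. diffs c m * t ^ m)) (at 0)"
    by (simp only: DERIV_shift)
  then have "deriv (\<lambda>s. ?\<phi> (s + t)) 0 = (\<Sum>m. diffs c m * t ^ m)"
    by (rule DERIV_imp_deriv)
  moreover have "pd b g (x + t *\<^sub>R b) = deriv (\<lambda>s. ?\<phi> (s + t)) 0"
    unfolding pd_def
  proof (rule deriv_cong_ev)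
    have "open {s. \<bar>s + t\<bar> < r}"
      by (intro open_Collect_less continuous_intros)
    then have "\<forall>\<^sub>F s in nhds 0. s \<in> {s. \<bar>s + t\<bar> < r}"
      using t by (intro eventually_nhds_in_open) auto
    then show "\<forall>\<^sub>F s in nhds 0. g (x + t *\<^sub>R b + s *\<^sub>R b) = ?\<phi> (s + t)"
    proof eventually_elim
      case (elim s)
      then show ?case
        using g[of "s + t"] by (simp add: sums_iff algebra_simps)
    qed
  qed simp
  ultimately show ?thesis
    using termdiff_converges[of t r c] summ t by (simp add: summable_sums)
qed

lemma pd_funpow_power_series:
  fixes g :: "'a::euclidean_space \<Rightarrow> real"
  assumes "\<And>t. \<bar>t\<bar> < r \<Longrightarrow> (\<lambda>m. c m * t ^ m) sums g (x + t *\<^sub>R b)" "\<bar>t\<bar> < r"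
  shows "(\<lambda>m. (diffs ^^ n) c m * t ^ m) sums (pd b ^^ n) g (x + t *\<^sub>R b)"
  using assms(2)
proof (induction n arbitrary: t)
  case 0
  then show ?case using assms(1) by simp
next
  case (Suc n)
  then show ?case
    using pd_power_series[of r "(diffs ^^ n) c" "(pd b ^^ n) g" x b t] by simp
qed

lemma diffs_funpow: "(diffs ^^ n) c m = fact (n + m) / fact m * (c (n + m) :: real)"
proof (induction n arbitrary: m)
  case (Suc n)
  have step: "diffs d m = real (Suc m) * d (Suc m)" for d :: "nat \<Rightarrow> real"
    by (simp add: diffs_def)
  have "(diffs ^^ Suc n) c m = real (Suc m) * (fact (n + Suc m) / fact (Suc m) * c (n + Suc m))"
    by (simp only: funpow.simps o_apply step Suc.IH)
  also have "\<dots> = fact (n + Suc m) / fact m * c (n + Suc m)"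
    by (simp add: fact_Suc[of m] del: of_nat_Suc)
  finally show ?case by simp
qed simp

text \<open>
  The derivatives in direction \<open>b\<close> see only the restriction to the line through \<open>x\<close>, which is a
  power series in one variable.
\<close>

lemma pd_funpow_at_origin:
  fixes g :: "'a::euclidean_space \<Rightarrow> real"
  assumes "0 < r" "\<And>t. \<bar>t\<bar> < r \<Longrightarrow> (\<lambda>m. t ^ m / fact m * c m) sums g (x + t *\<^sub>R b)"
  shows "(pd b ^^ n) g x = c n"
proof -
  have "(\<lambda>m. (diffs ^^ n) (\<lambda>m. c m / fact m) m * 0 ^ m) sums (pd b ^^ n) g (x + 0 *\<^sub>R b)"
    by (rule pd_funpow_power_series[of r]) (use assms in \<open>simp_all add: mult.commute\<close>)
  then have "(pd b ^^ n) g x = (diffs ^^ n) (\<lambda>m. c m / fact m) 0"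
    using powser_sums_zero_iff by auto
  then show ?thesis
    by (simp add: diffs_funpow)
qed

section \<open>Hamiltonian fields on the extended phase space\<close>

type_synonym 'd extended_phase_space = "(real^'d) \<times> (real^'d) \<times> real"

definition q_dir :: "'d::finite \<Rightarrow> 'd extended_phase_space" where
  "q_dir i = (axis i 1, 0, 0)"

definition p_dir :: "'d::finite \<Rightarrow> 'd extended_phase_space" where
  "p_dir i = (0, axis i 1, 0)"

definition eps_dir :: "'d::finite extended_phase_space" where
  "eps_dir = (0, 0, 1)"

lemma Basis_extended_phase_space:
  "(Basis :: 'd::finite extended_phase_space set) = range q_dir \<union> range p_dir \<union> {eps_dir}"
  by (auto simp: Basis_prod_def Basis_vec_def q_dir_def p_dir_def eps_dir_def image_Un image_image zero_prod_def)

lemma dir_in_Basis: "q_dir i \<in> Basis" "p_dir i \<in> Basis" "eps_dir \<in> Basis"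
  by (auto simp: Basis_extended_phase_space)

lemma sum_Basis_extended_phase_space:
  fixes F :: "'d::finite extended_phase_space \<Rightarrow> real"
  shows "(\<Sum>b\<in>Basis. F b) = (\<Sum>i\<in>UNIV. F (q_dir i)) + (\<Sum>i\<in>UNIV. F (p_dir i)) + F eps_dir"
proof -
  have inj: "inj (q_dir :: 'd \<Rightarrow> _)" "inj (p_dir :: 'd \<Rightarrow> _)"
    by (auto simp: inj_def q_dir_def p_dir_def axis_eq_axis)
  have disj: "range q_dir \<inter> range (p_dir :: 'd \<Rightarrow> _) = {}"
    "(range q_dir \<union> range (p_dir :: 'd \<Rightarrow> _)) \<inter> {eps_dir} = {}"
    by (auto simp: q_dir_def p_dir_def eps_dir_def axis_eq_0_iff)
  have "(\<Sum>b\<in>Basis. F b) = (\<Sum>b\<in>range q_dir. F b) + (\<Sum>b\<in>range p_dir. F b) + F eps_dir"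
    unfolding Basis_extended_phase_space
    using disj by (subst sum.union_disjoint; simp add: sum.union_disjoint)
  also have "\<dots> = (\<Sum>i\<in>UNIV. F (q_dir i)) + (\<Sum>i\<in>UNIV. F (p_dir i)) + F eps_dir"
    using inj by (simp add: sum.reindex)
  finally show ?thesis .
qed

text \<open>
  The Poisson bracket in the variables \<open>q\<close> and \<open>p\<close>, with \<open>\<epsilon>\<close> as a parameter.
\<close>

definition bracket ::
    "('d::finite extended_phase_space \<Rightarrow> real) \<Rightarrow> ('d extended_phase_space \<Rightarrow> real) \<Rightarrow>
      'd extended_phase_space \<Rightarrow> real" where
  "bracket g h x = (\<Sum>i\<in>UNIV. pd (q_dir i) g x * pd (p_dir i) h x - pd (p_dir i) g x * pd (q_dir i) h x)"

text \<open>
  The last component \<open>1\<close> makes the parameter \<open>\<epsilon>\<close> run along with the time, so that a solution of the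
  time-dependent Hamilton equations is a trajectory of this field.
\<close>

definition hamiltonian_field ::
    "('d::finite extended_phase_space \<Rightarrow> real) \<Rightarrow> 'd extended_phase_space \<Rightarrow> 'd extended_phase_space"
  where
  "hamiltonian_field W x = (\<chi> i. pd (p_dir i) W x, \<chi> i. - pd (q_dir i) W x, 1)"

lemma hamiltonian_field_inner:
  "hamiltonian_field W x \<bullet> q_dir i = pd (p_dir i) W x"
  "hamiltonian_field W x \<bullet> p_dir i = - pd (q_dir i) W x"
  "hamiltonian_field W x \<bullet> eps_dir = 1"
  by (simp_all add: hamiltonian_field_def q_dir_def p_dir_def eps_dir_def inner_axis)

lemma lieD_hamiltonian_field:
  "lieD (hamiltonian_field W) g x = pd eps_dir g x + bracket g W x"
  by (simp add: lieD_def sum_Basis_extended_phase_space hamiltonian_field_inner bracket_def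
      sum_subtractf sum_negf mult.commute)

text \<open>
  This is the recursion for the functions \<open>f\<^sup>k\<^sub>n\<close> before restriction to \<open>\<epsilon> = 0\<close>.
\<close>

lemma pd_funpow_lieD:
  assumes g: "power_series_on_cube a r g" and W: "power_series_on_cube a r W" and x: "x \<in> cube a r"
  shows "(pd eps_dir ^^ n) (lieD (hamiltonian_field W) g) x =
    (pd eps_dir ^^ Suc n) g x +
    (\<Sum>m\<le>n. real (n choose m) * bracket ((pd eps_dir ^^ (n - m)) g) ((pd eps_dir ^^ m) W) x)"
proof -
  let ?E = "pd eps_dir"
  let ?T = "\<lambda>i x. pd (q_dir i) g x * pd (p_dir i) W x - pd (p_dir i) g x * pd (q_dir i) W x"
  have ps: "power_series_on_cube a r (pd b h)" if "h = g \<or> h = W" "b \<in> Basis" for b h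
    using that g W power_series_on_cube_pd by blast
  have psT: "power_series_on_cube a r (?T i)" for i
    by (intro power_series_on_cube_diff power_series_on_cube_mult ps dir_in_Basis) auto
  have psB: "power_series_on_cube a r (bracket g W)"
    unfolding bracket_def[abs_def] by (intro power_series_on_cube_sum psT) simp
  have product: "(?E ^^ n) (\<lambda>x. pd b g x * pd b' W x) x =
      (\<Sum>m\<le>n. real (n choose m) * (pd b ((?E ^^ (n - m)) g) x * pd b' ((?E ^^ m) W) x))"
    if "b \<in> Basis" "b' \<in> Basis" for b b'
    using pd_funpow_mult[OF ps[of g b] ps[of W b'] dir_in_Basis(3) x, of n]
      pd_funpow_commute[OF g dir_in_Basis(3) that(1) x] pd_funpow_commute[OF W dir_in_Basis(3) that(2) x]
    by (simp add: that)
  have "(?E ^^ n) (?T i) x = (\<Sum>m\<le>n. real (n choose m) *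
      (pd (q_dir i) ((?E ^^ (n - m)) g) x * pd (p_dir i) ((?E ^^ m) W) x -
       pd (p_dir i) ((?E ^^ (n - m)) g) x * pd (q_dir i) ((?E ^^ m) W) x))" for i
    using pd_funpow_diff[OF power_series_on_cube_mult[OF ps ps] power_series_on_cube_mult[OF ps ps]
        dir_in_Basis(3) x, of g "q_dir i" W "p_dir i" g "p_dir i" W "q_dir i" n]
    by (simp add: product dir_in_Basis right_diff_distrib sum_subtractf)
  then have bracket: "(?E ^^ n) (bracket g W) x =
      (\<Sum>m\<le>n. real (n choose m) * bracket ((?E ^^ (n - m)) g) ((?E ^^ m) W) x)"
    unfolding bracket_def[abs_def]
    by (simp only: pd_funpow_sum[OF finite psT dir_in_Basis(3) x])
      (simp add: sum_distrib_left, rule sum.swap)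
  \<comment> \<open>The sum \<open>L g = \<partial>g/\<partial>\<epsilon> + {g; W}\<close> is written as a difference, so that linearity is only needed in the form of the difference rule.\<close>
  have "power_series_on_cube a r (\<lambda>x. ?E g x - (- 1) * bracket g W x)"
    by (intro power_series_on_cube_diff power_series_on_cube_cmult psB ps dir_in_Basis) simp
  then have psL: "power_series_on_cube a r (lieD (hamiltonian_field W) g)"
    by (simp add: lieD_hamiltonian_field[abs_def])
  have "(?E ^^ n) (?E g) x = (?E ^^ n) (\<lambda>x. lieD (hamiltonian_field W) g x - bracket g W x) x"
    by (simp add: lieD_hamiltonian_field)
  also have "\<dots> = (?E ^^ n) (lieD (hamiltonian_field W) g) x - (?E ^^ n) (bracket g W) x"
    by (rule pd_funpow_diff[OF psL psB dir_in_Basis(3) x])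
  finally show ?thesis
    by (simp add: bracket funpow_swap1)
qed

lemma partial_q_eq_pd: "partial_q i g x y = pd (axis i 1, 0) (\<lambda>(x, y). g x y) (x, y)"
  by (simp add: partial_q_def pd_def)

lemma partial_p_eq_pd: "partial_p i g x y = pd (0, axis i 1) (\<lambda>(x, y). g x y) (x, y)"
  by (simp add: partial_p_def pd_def)

text \<open>
  The derivatives in the bracket are taken at \<open>\<epsilon> = 0\<close> in directions that leave \<open>\<epsilon>\<close> fixed, so they
  depend only on the restrictions to \<open>\<epsilon> = 0\<close>. Agreement on an open set is needed because the
  bracket looks at neighbouring points.
\<close>

lemma poisson_bracket_eq_bracket:
  assumes "open S" "(x, y) \<in> S"
    and "\<And>x y. (x, y) \<in> S \<Longrightarrow> g x y = G (x, y, 0)" "\<And>x y. (x, y) \<in> S \<Longrightarrow> h x y = H (x, y, 0)"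
  shows "poisson_bracket g h x y = bracket G H (x, y, 0)"
proof -
  have part: "partial_q i k x y = pd (q_dir i) K (x, y, 0)" "partial_p i k x y = pd (p_dir i) K (x, y, 0)"
    if "\<And>x y. (x, y) \<in> S \<Longrightarrow> k x y = K (x, y, 0)" for k K i
    unfolding partial_q_eq_pd partial_p_eq_pd
    using that
    by (subst pd_cong[OF assms(1,2), where h = "\<lambda>(x, y). K (x, y, 0)"];
        auto simp: pd_def q_dir_def p_dir_def)+
  show ?thesis
    unfolding poisson_bracket_def bracket_def
    by (simp add: part[where K = G] part[where K = H] assms)
qed

text \<open>
  The generalization to all \<open>n\<close> is what makes the induction on \<open>k\<close> work: column \<open>n\<close> of the
  triangular scheme at level \<open>k + 1\<close> uses the columns up to \<open>n + 1\<close> at level \<open>k\<close>.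
\<close>

lemma lie_coeff_eq_pd_funpow:
  fixes S :: "((real^'d::finite) \<times> (real^'d)) set"
  assumes S: "open S" and in_cube: "\<And>x y. (x, y) \<in> S \<Longrightarrow> (x, y, 0) \<in> cube a r"
    and f: "\<And>k. power_series_on_cube a r ((lieD (hamiltonian_field W) ^^ k) f)"
    and W: "power_series_on_cube a r W"
    and fn: "\<And>n x y. (x, y) \<in> S \<Longrightarrow> (pd eps_dir ^^ n) f (x, y, 0) = fn n x y"
    and Wn: "\<And>n x y. (x, y) \<in> S \<Longrightarrow> (pd eps_dir ^^ n) W (x, y, 0) = Wn n x y"
    and "(x, y) \<in> S"
  shows "lie_coeff fn Wn k n x y = (pd eps_dir ^^ n) ((lieD (hamiltonian_field W) ^^ k) f) (x, y, 0)"
  using assms(7)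
proof (induction k arbitrary: n x y)
  case 0
  then show ?case by (simp add: fn)
next
  case (Suc k)
  have "poisson_bracket (lie_coeff fn Wn k (n - m)) (Wn m) x y =
      bracket ((pd eps_dir ^^ (n - m)) ((lieD (hamiltonian_field W) ^^ k) f)) ((pd eps_dir ^^ m) W) (x, y, 0)"
    for m
    by (rule poisson_bracket_eq_bracket[OF S Suc.prems]) (simp_all add: Suc.IH Wn)
  then show ?case
    using pd_funpow_lieD[OF f W in_cube[OF Suc.prems], of n k]
    by (simp add: Suc.IH[OF Suc.prems] atLeast0AtMost)
qed


lemma ball_subset_cube: "ball a r \<subseteq> cube a r"
proof
  fix x assume "x \<in> ball a r"
  then have "norm (x - a) < r"
    by (simp add: dist_norm norm_minus_commute)
  then show "x \<in> cube a r"
    unfolding mem_cube using le_less_trans[OF Basis_le_norm] by blast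
qed

lemma majorized_hamiltonian_field:
  assumes W: "majorized a r N W" and s: "0 < s" "s < r" and b: "b \<in> Basis"
  shows "majorized a s (max 1 (N / (r - s))) (\<lambda>x. hamiltonian_field W x \<bullet> b)"
proof -
  have pd: "majorized a s (N / (r - s)) (pd c W)" if "c \<in> Basis" for c
    by (rule majorized_pd[OF W that]) (use s in auto)
  have "majorized a s (1 * (N / (r - s))) (\<lambda>x. (- 1) * pd c W x)" if "c \<in> Basis" for c
    using majorized_mult[OF majorized_const[of a s "- 1"] pd[OF that]] s by simp
  then have "majorized a s (N / (r - s)) (\<lambda>x. - pd c W x)" if "c \<in> Basis" for c
    using that by simp
  note neg = this
  have weaken: "majorized a s (max 1 (N / (r - s))) h" if "majorized a s k h" "k \<le> max 1 (N / (r - s))" for k h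
    using majorized_weaken[OF that(1) order_refl _ that(2)] s by simp
  consider i where "b = q_dir i" | i where "b = p_dir i" | "b = eps_dir"
    using b by (auto simp: Basis_extended_phase_space)
  then show ?thesis
  proof cases
    case (1 i)
    then show ?thesis
      using weaken[OF pd[OF dir_in_Basis(2)]] by (simp add: hamiltonian_field_inner)
  next
    case (2 i)
    then show ?thesis
      using weaken[OF neg[OF dir_in_Basis(1)]] by (simp add: hamiltonian_field_inner)
  next
    case 3
    then show ?thesis
      using weaken[OF majorized_const[of a s 1]] by (simp add: hamiltonian_field_inner)
  qed
qed

lemma pd_funpow_eps_eq_taylor_coeff:
  fixes \<Omega> :: "'d::finite extended_phase_space set"
  assumes "open \<Omega>" "(x, y, 0) \<in> \<Omega>"
    and sums: "\<And>\<epsilon>. (x, y, \<epsilon>) \<in> \<Omega> \<Longrightarrow> (\<lambda>n. \<epsilon> ^ n / fact n * c n) sums g (x, y, \<epsilon>)"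
  shows "(pd eps_dir ^^ n) g (x, y, 0) = c n"
proof -
  obtain r where r: "0 < r" "ball (x, y, 0) r \<subseteq> \<Omega>"
    using assms(1,2) openE by blast
  have "(x, y, t) \<in> \<Omega>" if "\<bar>t\<bar> < r" for t
  proof -
    have "dist (x, y, 0) (x, y, t) < r"
      using that by (simp add: dist_Pair_Pair dist_real_def)
    then show ?thesis using r(2) by auto
  qed
  then show ?thesis
    using sums by (intro pd_funpow_at_origin[OF r(1)]) (simp add: eps_dir_def)
qed

theorem proposition3p2p5:
  fixes D :: "((real^'d) \<times> (real^'d)) set"
    and \<Omega> :: "((real^'d) \<times> (real^'d) \<times> real) set"
    and f W :: "real^'d \<Rightarrow> real^'d \<Rightarrow> real \<Rightarrow> real"
    and fn Wn :: "nat \<Rightarrow> real^'d \<Rightarrow> real^'d \<Rightarrow> real"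
    and q p :: "real^'d \<Rightarrow> real^'d \<Rightarrow> real \<Rightarrow> real^'d"
    and \<delta> :: "real^'d \<Rightarrow> real^'d \<Rightarrow> real"
  assumes "open D" and "open \<Omega>"
    and "\<And>x y. (x, y) \<in> D \<Longrightarrow> (x, y, 0) \<in> \<Omega>"
    and "\<And>x y \<epsilon>. (x, y, \<epsilon>) \<in> \<Omega> \<Longrightarrow> (x, y) \<in> D"
    and "real_analytic_on (\<lambda>(x, y, \<epsilon>). f x y \<epsilon>) \<Omega>"
    and "real_analytic_on (\<lambda>(x, y, \<epsilon>). W x y \<epsilon>) \<Omega>"
    and "\<And>x y \<epsilon>. (x, y, \<epsilon>) \<in> \<Omega> \<Longrightarrow> (\<lambda>n. \<epsilon> ^ n / fact n * fn n x y) sums f x y \<epsilon>"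
    and "\<And>x y \<epsilon>. (x, y, \<epsilon>) \<in> \<Omega> \<Longrightarrow> (\<lambda>n. \<epsilon> ^ n / fact n * Wn n x y) sums W x y \<epsilon>"
    and "\<And>Q P. (Q, P) \<in> D \<Longrightarrow> \<delta> Q P > 0"
    and "\<And>Q P. (Q, P) \<in> D \<Longrightarrow> q Q P 0 = Q"
    and "\<And>Q P. (Q, P) \<in> D \<Longrightarrow> p Q P 0 = P"
    and "\<And>Q P \<epsilon>. (Q, P) \<in> D \<Longrightarrow> \<bar>\<epsilon>\<bar> < \<delta> Q P \<Longrightarrow> (q Q P \<epsilon>, p Q P \<epsilon>, \<epsilon>) \<in> \<Omega>"
    and "\<And>Q P \<epsilon>. (Q, P) \<in> D \<Longrightarrow> \<bar>\<epsilon>\<bar> < \<delta> Q P \<Longrightarrow>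
           (q Q P has_vector_derivative
              (\<chi> i. partial_p i (\<lambda>x y. W x y \<epsilon>) (q Q P \<epsilon>) (p Q P \<epsilon>))) (at \<epsilon>)"
    and "\<And>Q P \<epsilon>. (Q, P) \<in> D \<Longrightarrow> \<bar>\<epsilon>\<bar> < \<delta> Q P \<Longrightarrow>
           (p Q P has_vector_derivative
              (\<chi> i. - partial_q i (\<lambda>x y. W x y \<epsilon>) (q Q P \<epsilon>) (p Q P \<epsilon>))) (at \<epsilon>)"
  shows "\<forall>z\<in>D. \<exists>U \<epsilon>0. open U \<and> z \<in> U \<and> U \<subseteq> D \<and> \<epsilon>0 > 0 \<and>
           (\<forall>Q P \<epsilon>. (Q, P) \<in> U \<and> \<bar>\<epsilon>\<bar> < \<epsilon>0 \<and> \<bar>\<epsilon>\<bar> < \<delta> Q P \<longrightarrow>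
              (\<lambda>n. \<epsilon> ^ n / fact n * lie_coeff fn Wn n 0 Q P) sums
                f (q Q P \<epsilon>) (p Q P \<epsilon>) \<epsilon>)"
proof
  fix z assume "z \<in> D"
  define f' where "f' = (\<lambda>(x, y, \<epsilon>). f x y \<epsilon>)"
  define W' where "W' = (\<lambda>(x, y, \<epsilon>). W x y \<epsilon>)"
  define a where "a = (fst z, snd z, 0 :: real)"
  let ?V = "hamiltonian_field W'"
  have a: "a \<in> \<Omega>"
    using \<open>z \<in> D\<close> assms(3)[of "fst z" "snd z"] by (simp add: a_def)
  obtain r\<^sub>f N\<^sub>f where f: "0 < r\<^sub>f" "majorized a r\<^sub>f N\<^sub>f f'"
    using real_analytic_imp_majorized[OF assms(5) a] unfolding f'_def .
  obtain r\<^sub>W N\<^sub>W where W: "0 < r\<^sub>W" "majorized a r\<^sub>W N\<^sub>W W'"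
    using real_analytic_imp_majorized[OF assms(6) a] unfolding W'_def .
  \<comment> \<open>The estimate for the components of the field needs a radius strictly below \<open>r\<^sub>W\<close>; the maximum with 1 covers the last component.\<close>
  define R where "R = min r\<^sub>f (r\<^sub>W / 2)"
  define M where "M = max 1 (N\<^sub>W / (r\<^sub>W - R))"
  have R: "0 < R" "R \<le> r\<^sub>f" "R < r\<^sub>W"
    using f(1) W(1) by (auto simp: R_def)
  have M: "0 < M"
    by (simp add: M_def)
  have V: "majorized a R M (\<lambda>x. ?V x \<bullet> b)" if "b \<in> Basis" for b
    unfolding M_def by (rule majorized_hamiltonian_field[OF W(2) R(1,3) that])
  have fR: "majorized a R N\<^sub>f f'"
    using majorized_weaken[OF f(2) R(2)] R(1) by simp
  define U where "U = D \<inter> ball z (R / 4)"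
  define \<epsilon>0 where "\<epsilon>0 = min (R / (4 * M)) (R / (2 * DIM('d extended_phase_space) * M * exp 1))"
  have U: "(x, y) \<in> D" "(x, y, 0) \<in> cube a (R / 4)" if "(x, y) \<in> U" for x y
  proof -
    have "dist a (x, y, 0) < R / 4"
      using that by (cases z) (simp add: U_def a_def dist_Pair_Pair)
    then show "(x, y, 0) \<in> cube a (R / 4)"
      by (intro subsetD[OF ball_subset_cube]) (simp only: mem_ball)
  qed (use that in \<open>simp add: U_def\<close>)
  have coeff: "lie_coeff fn Wn n 0 x y = (lieD ?V ^^ n) f' (x, y, 0)" if "(x, y) \<in> U" for n x y
  proof -
    have "lie_coeff fn Wn n 0 x y = (pd eps_dir ^^ 0) ((lieD ?V ^^ n) f') (x, y, 0)"
    proof (rule lie_coeff_eq_pd_funpow[where S = U and a = a and r = "R / 2"])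
      show "open U"
        using assms(1) by (simp add: U_def open_Int)
      show "(x, y, 0) \<in> cube a (R / 2)" if "(x, y) \<in> U" for x y
        using U(2)[OF that] cube_mono[of "R / 4" "R / 2" a] R by auto
      show "power_series_on_cube a (R / 2) ((lieD ?V ^^ k) f')" for k
        by (rule majorized_imp_power_series_on_cube[OF majorized_lieD_power[OF V fR R(1)]])
      show "power_series_on_cube a (R / 2) W'"
        by (rule majorized_imp_power_series_on_cube, rule majorized_weaken[OF W(2)]) (use R in auto)
      show "(pd eps_dir ^^ n) f' (x, y, 0) = fn n x y" if "(x, y) \<in> U" for n x y
        by (rule pd_funpow_eps_eq_taylor_coeff[OF assms(2)])
          (use U(1)[OF that] assms(3,7) in \<open>auto simp: f'_def\<close>)
      show "(pd eps_dir ^^ n) W' (x, y, 0) = Wn n x y" if "(x, y) \<in> U" for n x y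
        by (rule pd_funpow_eps_eq_taylor_coeff[OF assms(2)])
          (use U(1)[OF that] assms(3,8) in \<open>auto simp: W'_def\<close>)
    qed (rule that)
    then show ?thesis by simp
  qed
  have "(\<lambda>n. \<epsilon> ^ n / fact n * lie_coeff fn Wn n 0 Q P) sums f (q Q P \<epsilon>) (p Q P \<epsilon>) \<epsilon>"
    if QP: "(Q, P) \<in> U" and \<epsilon>: "\<bar>\<epsilon>\<bar> < \<epsilon>0" "\<bar>\<epsilon>\<bar> < \<delta> Q P" for Q P \<epsilon>
  proof -
    define \<gamma> where "\<gamma> t = (q Q P t, p Q P t, t)" for t
    have \<gamma>0: "\<gamma> 0 = (Q, P, 0)"
      using assms(10,11) U(1)[OF QP] by (simp add: \<gamma>_def)
    have "(\<gamma> has_vector_derivative ?V (\<gamma> t)) (at t)" if "\<bar>t\<bar> \<le> \<bar>\<epsilon>\<bar>" for t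
    proof -
      have V_eq: "?V (\<gamma> t) =
          (\<chi> i. partial_p i (\<lambda>x y. W x y t) (q Q P t) (p Q P t),
           \<chi> i. - partial_q i (\<lambda>x y. W x y t) (q Q P t) (p Q P t), 1)"
        by (simp add: hamiltonian_field_def pd_def p_dir_def q_dir_def W'_def \<gamma>_def
            partial_p_def partial_q_def)
      show ?thesis
        unfolding V_eq unfolding \<gamma>_def[abs_def]
        using that \<epsilon>(2) U(1)[OF QP]
        by (intro has_vector_derivative_Pair assms(13,14) has_vector_derivative_id) auto
    qed
    then have "(\<lambda>n. \<epsilon> ^ n / fact n * (lieD ?V ^^ n) f' (\<gamma> 0)) sums f' (\<gamma> \<epsilon>)"
      using \<epsilon>(1) U(2)[OF QP]
      by (intro lie_series_sums_along_trajectory[OF V fR R(1) M]) (auto simp: \<gamma>0 \<epsilon>0_def)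
    then show ?thesis
      by (simp add: \<gamma>0 coeff[OF QP]) (simp add: f'_def \<gamma>_def)
  qed
  moreover have "open U" "z \<in> U" "U \<subseteq> D" "0 < \<epsilon>0"
    using assms(1) \<open>z \<in> D\<close> R(1) M by (auto simp: U_def \<epsilon>0_def open_Int)
  ultimately show "\<exists>U \<epsilon>0. open U \<and> z \<in> U \<and> U \<subseteq> D \<and> \<epsilon>0 > 0 \<and>
           (\<forall>Q P \<epsilon>. (Q, P) \<in> U \<and> \<bar>\<epsilon>\<bar> < \<epsilon>0 \<and> \<bar>\<epsilon>\<bar> < \<delta> Q P \<longrightarrow>
              (\<lambda>n. \<epsilon> ^ n / fact n * lie_coeff fn Wn n 0 Q P) sums
                f (q Q P \<epsilon>) (p Q P \<epsilon>) \<epsilon>)"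
    by blast
qed

end
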